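(* Let $v\ge 1$ be an integer, $\rho>0$, $\lambda\in(0,\infty)^v$, $\Lambda=\mathrm{diag}(\lambda_1,\dots,\lambda_v)$, $|\Lambda|=\det\Lambda$, let $s>0$ be an arbitrary constant, and let $j,k\in\{1,\dots,v\}$. The integrals $\alpha_k$ and $\alpha_{jk}$ admit the series representations $$\alpha_k(\rho;\lambda)=\sum_{m=0}^{\infty}c_{k;m}(s;\lambda)\,F_{v+2(m+1)}(\rho/s),\qquad \alpha_{jk}(\rho;\lambda)=\sum_{m=0}^{\infty}c_{jk;m}(s;\lambda)\,F_{v+2(m+2)}(\rho/s),$$ with coefficients $$c_{k;m}(s;\lambda)=\frac{s}{\lambda_k}\,\frac{v+2m}{m!}\,\frac{s^{v/2+m}}{|\Lambda|^{1/2}}\,\frac{\Gamma(v/2+m)}{\Gamma(v/2)}\,\mathbb{M}\left[(-Q)^m u_k^2\right],$$ $$c_{jk;m}(s;\lambda)=\frac{s}{\lambda_j}\frac{s}{\lambda_k}\,\frac{(v+2m+2)(v+2m)}{m!}\,\frac{s^{v/2+m}}{|\Lambda|^{1/2}}\,\frac{\Gamma(v/2+m)}{\Gamma(v/2)}\,\mathbb{M}\left[(-Q)^m u_j^2u_k^2\right].$$ Both series converge uniformly in $\rho$ on every finite interval. The functions $$\psi_k(z)=\left(\frac{s}{\lambda_k}\right)^{3/2}\left[1-\left(1-\frac{s}{\lambda_k}\right)z\right]^{-3/2}\prod_{i\ne k}\left(\frac{s}{\lambda_i}\right)^{1/2}\left[1-\left(1-\frac{s}{\lambda_i}\right)z\right]^{-1/2},$$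 $$\psi_{kk}(z)=3\left(\frac{s}{\lambda_k}\right)^{5/2}\left[1-\left(1-\frac{s}{\lambda_k}\right)z\right]^{-5/2}\prod_{i\ne k}\left(\frac{s}{\lambda_i}\right)^{1/2}\left[1-\left(1-\frac{s}{\lambda_i}\right)z\right]^{-1/2},$$ and, for $j\neq k$, $$\psi_{jk}(z)=\left(\frac{s}{\lambda_j}\frac{s}{\lambda_k}\right)^{3/2}\left\{\left[1-\left(1-\frac{s}{\lambda_j}\right)z\right]\left[1-\left(1-\frac{s}{\lambda_k}\right)z\right]\right\}^{-3/2}\prod_{i\ne j,k}\left(\frac{s}{\lambda_i}\right)^{1/2}\left[1-\left(1-\frac{s}{\lambda_i}\right)z\right]^{-1/2},$$ are generating functions for the coefficients $c_{k;m}$, $c_{kk;m}$ and $c_{jk;m}$ ($j\ne k$) respectively, i.e. $$\psi_k(z)=\sum_{m=0}^\infty c_{k;m}(s;\lambda)z^m,\qquad \psi_{jk}(z)=\sum_{m=0}^\infty c_{jk;m}(s;\lambda)z^m\quad(\text{both for } j=k \text{ and } j\ne k)$$ for $|z|<\min_i|1-s/\lambda_i|^{-1}$. Finally, with $c_0=\prod_{m=1}^v\sqrt{s/\lambda_m}$, the coefficients can be obtained from the recursions $$c_{k;0}=\frac{s}{\lambda_k}c_0,\qquad c_{k;m}=\frac{1}{2m}\sum_{r=0}^{m-1}g_{k;m-r}\,c_{k;r},\qquad g_{k;m}=\sum_{i=1}^v e_{k;i}\left(1-\frac{s}{\lambda_i}\right)^m,\qquad m\ge 1,$$ and $$c_{jk;0}=(1+2\delta_{jk})\frac{s}{\lambda_j}\frac{s}{\lambda_k}c_0,\qquad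 c_{jk;m}=\frac{1}{2m}\sum_{r=0}^{m-1}g_{jk;m-r}\,c_{jk;r},\qquad g_{jk;m}=\sum_{i=1}^v e_{jk;i}\left(1-\frac{s}{\lambda_i}\right)^m,\qquad m\ge 1,$$ where $\delta_{jk}$ is the Kronecker symbol and the auxiliary coefficients are: $e_{k;i}=3$ if $i=k$ and $1$ otherwise; $e_{kk;i}=5$ if $i=k$ and $1$ otherwise; and, for $j\neq k$, $e_{jk;i}=3$ if $i=j$ or $i=k$ and $1$ otherwise.
   Context: $\mathcal{B}_v(\rho)=\{x\in\mathbb{R}^v:\ x^{T}x\le\rho\}$. For $\eta>0$ and $y\in\mathbb{R}$, $\delta(y,\eta)=\frac{1}{\sqrt{2\pi\eta}}\exp\{-\frac{y^2}{2\eta}\}$ (a function of two arguments, not to be confused with the Kronecker symbol $\delta_{jk}$). For $\lambda\in(0,\infty)^v$, $$\alpha_k(\rho;\lambda)=\int_{\mathcal{B}_v(\rho)}d^vx\,\frac{x_k^2}{\lambda_k}\prod_{n=1}^v\delta(x_n,\lambda_n),\qquad \alpha_{jk}(\rho;\lambda)=\int_{\mathcal{B}_v(\rho)}d^vx\,\frac{x_j^2}{\lambda_j}\frac{x_k^2}{\lambda_k}\prod_{n=1}^v\delta(x_n,\lambda_n),$$ where $j=k$ is allowed in the second integral. $F_n$ denotes the cumulative distribution function of a $\chi^2$ variable with $n$ degrees of freedom. $Q(x)=x^{T}[\Lambda^{-1}-s^{-1}\mathbb{I}_v]x$ for $x\in\mathbb{R}^v$, with $\mathbb{I}_v$ the identity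 matrix. $\mathbb{M}$ is the uniform average over the unit sphere $\partial\mathcal{B}_v(1)=\{u\in\mathbb{R}^v:\ u^{T}u=1\}$: $$\mathbb{M}[\phi]=\frac{\Gamma(v/2)}{2\pi^{v/2}}\int_{\partial\mathcal{B}_v(1)}du\,\phi(u),$$ so that $\mathbb{M}[(-Q)^mu_k^2]$ is the average of $u\mapsto(-Q(u))^mu_k^2$, and similarly for $u_j^2u_k^2$. In $\min_i|1-s/\lambda_i|^{-1}$, terms with $s=\lambda_i$ are read as $+\infty$. *)

theory Defs
  imports "HOL-Probability.Probability"
begin

(* Throughout, R^v is real^'n with v = CARD('n), and indices in {1..v} are elements of 'n. *)

definition square_ball :: "real \<Rightarrow> (real^'n) set" where
  "square_ball \<rho> = {x. x \<bullet> x \<le> \<rho>}"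

definition gauss_delta :: "real \<Rightarrow> real \<Rightarrow> real" where
  "gauss_delta y \<eta> = 1 / sqrt (2 * pi * \<eta>) * exp (- (y\<^sup>2 / (2 * \<eta>)))"

definition alpha1 :: "real \<Rightarrow> real^'n \<Rightarrow> 'n \<Rightarrow> real" where
  "alpha1 \<rho> lam k =
     (LINT x:square_ball \<rho>|lborel. (x$k)\<^sup>2 / lam$k * (\<Prod>n\<in>UNIV. gauss_delta (x$n) (lam$n)))"

definition alpha2 :: "real \<Rightarrow> real^'n \<Rightarrow> 'n \<Rightarrow> 'n \<Rightarrow> real" where
  "alpha2 \<rho> lam j k =
     (LINT x:square_ball \<rho>|lborel.
        (x$j)\<^sup>2 / lam$j * ((x$k)\<^sup>2 / lam$k) * (\<Prod>n\<in>UNIV. gauss_delta (x$n) (lam$n)))"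

definition chi_square :: "nat \<Rightarrow> real measure" where
  "chi_square n = density lborel (\<lambda>x. ennreal
     (if 0 < x
      then x powr (real n / 2 - 1) * exp (- x / 2) / (2 powr (real n / 2) * Gamma (real n / 2))
      else 0))"

abbreviation chi_square_cdf :: "nat \<Rightarrow> real \<Rightarrow> real" where
  "chi_square_cdf n \<equiv> cdf (chi_square n)"

(* The surface measure du, normalised by the polar decomposition d^v x = r^(v-1) dr du: the area
   of A is v times the volume of the cone {r u | 0 < r \<le> 1, u \<in> A}.
   For v = 1 it is counting measure on {-1, 1}. *)
definition sphere_measure :: "'a::euclidean_space measure" where
  "sphere_measure = scale_measure (of_nat DIM('a))
     (distr (restrict_space lborel (cball 0 1 - {0})) (restrict_space borel (sphere 0 1))
        (\<lambda>x. x /\<^sub>R norm x))"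

definition sphere_mean :: "(real^'n \<Rightarrow> real) \<Rightarrow> real" where
  "sphere_mean \<phi> =
     Gamma (real CARD('n) / 2) / (2 * pi powr (real CARD('n) / 2)) * (\<integral>u. \<phi> u \<partial>sphere_measure)"

lemma space_sphere_measure: "space (sphere_measure :: 'a::euclidean_space measure) = sphere 0 1"
  by (simp add: sphere_measure_def space_scale_measure space_restrict_space)

lemma normalize_measurable:
  "(\<lambda>x::'a::euclidean_space. x /\<^sub>R norm x) \<in>
     restrict_space lborel (cball 0 1 - {0}) \<rightarrow>\<^sub>M restrict_space borel (sphere 0 1)"
  by (rule measurable_restrict_space3) auto

lemma emeasure_sphere_measure:
  fixes A :: "'a::euclidean_space set"
  assumes "A \<in> sets borel" "A \<subseteq> sphere 0 1"
  shows "emeasure sphere_measure A =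
    of_nat DIM('a) * emeasure lborel {x \<in> cball 0 1 - {0}. x /\<^sub>R norm x \<in> A}"
proof -
  have A: "A \<in> sets (restrict_space borel (sphere 0 1))"
    using assms by (auto simp: sets_restrict_space_iff)
  have eq: "(\<lambda>x. x /\<^sub>R norm x) -` A \<inter> space (restrict_space lborel (cball 0 1 - {0})) =
      {x \<in> cball 0 1 - {0}. x /\<^sub>R norm x \<in> A}"
    by (auto simp: space_restrict_space)
  have "emeasure (restrict_space lborel (cball 0 1 - {0}))
      {x \<in> cball 0 1 - {0}. x /\<^sub>R norm x \<in> A} =
      emeasure lborel {x \<in> cball 0 1 - {0}. x /\<^sub>R norm x \<in> A}"
    by (rule emeasure_restrict_space) auto
  then show ?thesis
    unfolding sphere_measure_def emeasure_scale_measure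
      emeasure_distr[OF normalize_measurable A] eq by (rule arg_cong)
qed

lemma emeasure_sphere_measure_sphere:
  "emeasure (sphere_measure :: 'a::euclidean_space measure) (sphere 0 1) =
     ennreal (2 * pi powr (DIM('a) / 2) / Gamma (DIM('a) / 2))"
proof -
  have eq: "{x::'a \<in> cball 0 1 - {0}. x /\<^sub>R norm x \<in> sphere 0 1} = cball 0 1 - {0}"
    by auto
  have vol: "emeasure lborel (cball (0::'a) 1 - {0}) = ennreal (unit_ball_vol DIM('a))"
    by (subst emeasure_Diff) (auto simp: emeasure_cball)
  have "Gamma (real DIM('a) / 2 + 1) = real DIM('a) / 2 * Gamma (real DIM('a) / 2)"
    by (rule Gamma_plus1) (auto dest: nonpos_Ints_nonpos)
  then have area: "real DIM('a) * unit_ball_vol DIM('a) =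
      2 * pi powr (DIM('a) / 2) / Gamma (DIM('a) / 2)"
    by (simp only: unit_ball_vol_def) simp
  have "emeasure (sphere_measure :: 'a measure) (sphere 0 1) =
      of_nat DIM('a) * emeasure lborel {x::'a \<in> cball 0 1 - {0}. x /\<^sub>R norm x \<in> sphere 0 1}"
    by (rule emeasure_sphere_measure) auto
  also have "\<dots> = ennreal (real DIM('a)) * ennreal (unit_ball_vol DIM('a))"
    by (simp only: eq vol ennreal_of_nat_eq_real_of_nat)
  also have "\<dots> = ennreal (real DIM('a) * unit_ball_vol DIM('a))"
    by (rule ennreal_mult'[symmetric]) simp
  finally show ?thesis
    by (simp only: area)
qed

lemma sphere_mean_const: "sphere_mean (\<lambda>_ :: real^'n. c) = c"
proof -
  have pos: "Gamma (real CARD('n) / 2) > 0"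
    by (rule Gamma_real_pos) simp
  then have nz: "Gamma (real CARD('n) / 2) \<noteq> 0"
    by (rule less_imp_neq[symmetric])
  have "measure (sphere_measure :: (real^'n) measure) (sphere 0 1) =
      2 * pi powr (real CARD('n) / 2) / Gamma (real CARD('n) / 2)"
    using pos by (simp add: measure_def emeasure_sphere_measure_sphere)
  then show ?thesis
    using nz by (simp add: sphere_mean_def space_sphere_measure)
qed

definition diag_mat :: "real^'n \<Rightarrow> real^'n^'n" where
  "diag_mat lam = (\<chi> i j. if i = j then lam$i else 0)"

definition Q_form :: "real \<Rightarrow> real^'n \<Rightarrow> real^'n \<Rightarrow> real" where
  "Q_form s lam x = x \<bullet> ((matrix_inv (diag_mat lam) - (1 / s) *\<^sub>R mat 1) *v x)"

definition coeff1 :: "real \<Rightarrow> real^'n \<Rightarrow> 'n \<Rightarrow> nat \<Rightarrow> real" where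
  "coeff1 s lam k m =
     s / lam$k * ((real CARD('n) + 2 * real m) / fact m)
     * (s powr (real CARD('n) / 2 + real m) / sqrt (det (diag_mat lam)))
     * (Gamma (real CARD('n) / 2 + real m) / Gamma (real CARD('n) / 2))
     * sphere_mean (\<lambda>u. (- Q_form s lam u) ^ m * (u$k)\<^sup>2)"

definition coeff2 :: "real \<Rightarrow> real^'n \<Rightarrow> 'n \<Rightarrow> 'n \<Rightarrow> nat \<Rightarrow> real" where
  "coeff2 s lam j k m =
     s / lam$j * (s / lam$k)
     * ((real CARD('n) + 2 * real m + 2) * (real CARD('n) + 2 * real m) / fact m)
     * (s powr (real CARD('n) / 2 + real m) / sqrt (det (diag_mat lam)))
     * (Gamma (real CARD('n) / 2 + real m) / Gamma (real CARD('n) / 2))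
     * sphere_mean (\<lambda>u. (- Q_form s lam u) ^ m * (u$j)\<^sup>2 * (u$k)\<^sup>2)"

(* The generating functions are taken at complex z, with the principal branch of powr.
   The product over i in S collects the factors with exponent 1/2. *)
definition half_factors :: "real \<Rightarrow> real^'n \<Rightarrow> 'n set \<Rightarrow> complex \<Rightarrow> complex" where
  "half_factors s lam S z =
     (\<Prod>i\<in>S. of_real ((s / lam$i) powr (1/2)) * (1 - of_real (1 - s / lam$i) * z) powr (-(1/2)))"

definition psi1 :: "real \<Rightarrow> real^'n \<Rightarrow> 'n \<Rightarrow> complex \<Rightarrow> complex" where
  "psi1 s lam k z =
     of_real ((s / lam$k) powr (3/2)) * (1 - of_real (1 - s / lam$k) * z) powr (-(3/2))
     * half_factors s lam (UNIV - {k}) z"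

definition psi2 :: "real \<Rightarrow> real^'n \<Rightarrow> 'n \<Rightarrow> 'n \<Rightarrow> complex \<Rightarrow> complex" where
  "psi2 s lam j k z =
     (if j = k then
        3 * of_real ((s / lam$k) powr (5/2)) * (1 - of_real (1 - s / lam$k) * z) powr (-(5/2))
        * half_factors s lam (UNIV - {k}) z
      else
        of_real ((s / lam$j * (s / lam$k)) powr (3/2))
        * ((1 - of_real (1 - s / lam$j) * z) * (1 - of_real (1 - s / lam$k) * z)) powr (-(3/2))
        * half_factors s lam (UNIV - {j, k}) z)"

(* inverse 0 = \<infinity> in ereal *)
definition gen_radius :: "real \<Rightarrow> real^'n \<Rightarrow> ereal" where
  "gen_radius s lam = (MIN i. inverse (ereal \<bar>1 - s / lam$i\<bar>))"

definition c0 :: "real \<Rightarrow> real^'n \<Rightarrow> real" where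
  "c0 s lam = (\<Prod>i\<in>UNIV. sqrt (s / lam$i))"

definition e1 :: "'n \<Rightarrow> 'n \<Rightarrow> real" where
  "e1 k i = (if i = k then 3 else 1)"

definition e2 :: "'n \<Rightarrow> 'n \<Rightarrow> 'n \<Rightarrow> real" where
  "e2 j k i =
     (if j = k then (if i = k then 5 else 1) else (if i = j \<or> i = k then 3 else 1))"

definition g1 :: "real \<Rightarrow> real^'n \<Rightarrow> 'n \<Rightarrow> nat \<Rightarrow> real" where
  "g1 s lam k m = (\<Sum>i\<in>UNIV. e1 k i * (1 - s / lam$i) ^ m)"

definition g2 :: "real \<Rightarrow> real^'n \<Rightarrow> 'n \<Rightarrow> 'n \<Rightarrow> nat \<Rightarrow> real" where
  "g2 s lam j k m = (\<Sum>i\<in>UNIV. e2 j k i * (1 - s / lam$i) ^ m)"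

end

theory Submission
  imports Defs
begin

text \<open>Split the Gaussian density as exp(-|x|^2 / 2s) exp(-Q(x) / 2) and expand the second factor.
  Each term is a homogeneous polynomial times a radial function, so in polar coordinates it
  factors into a spherical mean and an incomplete Gamma integral, i.e. a chi-square distribution
  function; on bounded balls the expansion is dominated by an exponential series. Over all of
  the space the distribution function is 1, so the coefficients are Gaussian integrals of
  monomials times powers of Q. These split over the coordinates and turn
  the generating function into a product of binomial series, whose logarithmic derivative
  gives the recursions. Both families of coefficients are the cases p = e_k and p = e_j + e_k of
  the weight given by the product of the x_i^(2 p_i).\<close>

section \<open>Polar integration of homogeneous functions\<close>

text \<open>The spherical means in the coefficients are never evaluated on the sphere. The termwise
  identity is stated for an arbitrary Borel set \<open>A\<close> of values of |x|^2/s: a half-line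
  gives one term of the series, while \<open>A = UNIV\<close> rewrites the same coefficient as an
  integral over R^v, where the coordinates separate. Because s is arbitrary, this second evaluation
  has to be done for one m at a time. The absolute values of the terms add up to a multiple of the
  monomial weight times exp(-|x|^2/2s + |Q|/2), which grows along the i-th axis once lam_i < s/2, so
  no integrable majorant exists on R^v in general. Sum and integral are exchanged on bounded balls
  only, and everything about the coefficients is derived from finite expansions at fixed m. All
  weights have even degree 2N. The law of |x|^2 under such a weight is then a power of t with
  exponent v/2 + N - 1, which is why the degrees of freedom grow in steps of 2.\<close>

lemma nn_integral_lborel_scaleR:
  fixes f :: "'a::euclidean_space \<Rightarrow> ennreal"
  assumes [measurable]: "f \<in> borel_measurable borel" and c: "c > 0"
  shows "(\<integral>\<^sup>+x. f x \<partial>lborel) = ennreal (c ^ DIM('a)) * (\<integral>\<^sup>+x. f (c *\<^sub>R x) \<partial>lborel)"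
proof -
  have "(\<integral>\<^sup>+x. f x \<partial>lborel) =
      (\<integral>\<^sup>+x. f x \<partial>density (distr lborel borel (\<lambda>x::'a. 0 + c *\<^sub>R x))
        (\<lambda>_. ennreal (\<bar>c\<bar> ^ DIM('a))))"
    using lborel_affine[of c "0::'a"] c by simp
  also have "\<dots> = ennreal (c ^ DIM('a)) * (\<integral>\<^sup>+x. f (c *\<^sub>R x) \<partial>lborel)"
    using c by (subst nn_integral_density) (simp_all add: nn_integral_distr nn_integral_cmult)
  finally show ?thesis .
qed

lemma nn_integral_powr_from_0:
  assumes a: "a > 0" and t: "t \<ge> 0"
  shows "(\<integral>\<^sup>+x. ennreal (if 0 < x then x powr (a - 1) else 0) * indicator {..t} x \<partial>lborel) =
      ennreal (t powr a / a)"
proof -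
  have "((\<lambda>x. x powr (a - 1)) has_integral (t powr (a - 1 + 1) / (a - 1 + 1))) {0..t}"
    using a t by (intro has_integral_powr_from_0) auto
  then have "(\<integral>\<^sup>+x. ennreal (x powr (a - 1)) * indicator {0..t} x \<partial>lborel) =
      ennreal (t powr a / a)"
    by (intro nn_integral_has_integral_lebesgue') auto
  moreover have "(\<integral>\<^sup>+x. ennreal (if 0 < x then x powr (a - 1) else 0) * indicator {..t} x \<partial>lborel)
      = (\<integral>\<^sup>+x. ennreal (x powr (a - 1)) * indicator {0..t} x \<partial>lborel)"
    by (intro nn_integral_cong_AE AE_I[of _ _ "{0}"]) (auto split: split_indicator if_splits)
  ultimately show ?thesis by simp
qed

text \<open>Continuity is included because it yields measurability and integrability over balls.
  Scaling by r > 0 alone is inherited by positive parts, on which the reduction to nonnegative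
  functions rests.\<close>

definition homogeneous :: "nat \<Rightarrow> ('a::euclidean_space \<Rightarrow> real) \<Rightarrow> bool" where
  "homogeneous N h \<longleftrightarrow> continuous_on UNIV h \<and> (\<forall>r>0. \<forall>x. h (r *\<^sub>R x) = r ^ N * h x)"

lemma homogeneous_measurable: "homogeneous N h \<Longrightarrow> h \<in> borel_measurable borel"
  by (simp add: homogeneous_def borel_measurable_continuous_onI)

lemma homogeneous_integrable_ball:
  fixes h :: "'a::euclidean_space \<Rightarrow> real"
  assumes "homogeneous N h"
  shows "integrable lborel (\<lambda>x. indicator (cball 0 r) x *\<^sub>R h x)"
  using borel_integrable_compact[of "cball 0 r" h] assms
    continuous_on_subset[of UNIV h "cball 0 r"]
  by (auto simp: homogeneous_def indicator_scaleR_eq_if)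

text \<open>By scaling, both measures give the half-line up to t > 0 the mass C t^a.\<close>

lemma distr_homogeneous:
  fixes h :: "'a::euclidean_space \<Rightarrow> real"
  assumes hom: "homogeneous (2 * N) h" and nn: "\<And>x. h x \<ge> 0"
  defines "a \<equiv> DIM('a) / 2 + N"
  defines "C \<equiv> (LINT x:cball 0 1|lborel. h x)"
  shows "distr (density lborel h) borel (\<lambda>x. x \<bullet> x) =
    density lborel (\<lambda>t. ennreal (C * a * (if 0 < t then t powr (a - 1) else 0)))"
proof (rule measure_eqI_generator_eq[of "range atMost" UNIV _ _ "\<lambda>i. {..real i}"])
  have a: "a > 0" by (simp add: a_def add_pos_nonneg)
  note [measurable] = homogeneous_measurable[OF hom]
  have [measurable]: "cball (0::'a) 1 \<in> sets borel" by simp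
  have C: "C \<ge> 0" unfolding C_def set_lebesgue_integral_def
    using nn by (intro integral_nonneg_AE) auto
  have CI: "(\<integral>\<^sup>+x. ennreal (h x) * indicator (cball 0 1) x \<partial>lborel) = ennreal C"
  proof -
    have "ennreal (h x) * indicator (cball 0 1) x = ennreal (indicator (cball 0 1) x *\<^sub>R h x)"
      for x
      by (simp split: split_indicator)
    then show ?thesis
      unfolding C_def set_lebesgue_integral_def
      using nn_integral_eq_integral[OF homogeneous_integrable_ball[OF hom, of 1]] nn by simp
  qed
  show "Int_stable (range atMost :: real set set)"
    unfolding Int_stable_def by auto
  have fin: "emeasure (distr (density lborel h) borel (\<lambda>x. x \<bullet> x)) {..t} =
      ennreal (if t > 0 then C * t powr a else 0)" for t
  proof -
    have 1: "emeasure (distr (density lborel h) borel (\<lambda>x. x \<bullet> x)) {..t} =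
      (\<integral>\<^sup>+x. ennreal (h x) * indicator {..t} (x \<bullet> x) \<partial>lborel)"
      by (subst nn_integral_indicator[symmetric])
        (simp_all del: nn_integral_indicator add: nn_integral_distr nn_integral_density)
    show ?thesis
    proof (cases "t > 0")
      \<comment> \<open>For t <= 0 the set where \<open>x \<bullet> x\<close> is at most t lies in
        the origin, a null set.\<close>
      case False
      have "(\<integral>\<^sup>+x. ennreal (h x) * indicator {..t} (x \<bullet> x) \<partial>lborel) =
          (\<integral>\<^sup>+x. 0 \<partial>(lborel :: 'a measure))"
        using False
        by (intro nn_integral_cong_AE AE_I[of _ _ "{0}"]) 
           (auto split: split_indicator, smt (verit) inner_gt_zero_iff)
      with 1 False show ?thesis by simp
    next
      case True
      define r where "r = sqrt t"
      have r: "r > 0" "r\<^sup>2 = t" using True by (auto simp: r_def)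
      have "(\<integral>\<^sup>+x. ennreal (h x) * indicator {..t} (x \<bullet> x) \<partial>lborel) =
        ennreal (r ^ DIM('a)) * (\<integral>\<^sup>+x. ennreal (h (r *\<^sub>R x)) * indicator {..t}
          ((r *\<^sub>R x) \<bullet> (r *\<^sub>R x)) \<partial>lborel)"
        by (rule nn_integral_lborel_scaleR) (use r in auto)
      also have "(\<integral>\<^sup>+x. ennreal (h (r *\<^sub>R x)) * indicator {..t} ((r *\<^sub>R x) \<bullet> (r *\<^sub>R x)) \<partial>lborel) =
         (\<integral>\<^sup>+x. ennreal (r ^ (2*N)) * (ennreal (h x) * indicator (cball 0 1) x) \<partial>lborel)"
      proof (intro nn_integral_cong)
        fix x :: 'a
        have "(r *\<^sub>R x) \<bullet> (r *\<^sub>R x) \<le> t \<longleftrightarrow> r\<^sup>2 * (norm x)\<^sup>2 \<le> r\<^sup>2"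
          unfolding r(2)[symmetric]
            by (simp add: power2_norm_eq_inner) (simp add: power2_eq_square mult.assoc)
        also have "\<dots> \<longleftrightarrow> norm x \<le> 1" using r(1) by (simp add: abs_square_le_1)
        finally show "ennreal (h (r *\<^sub>R x)) * indicator {..t} ((r *\<^sub>R x) \<bullet> (r *\<^sub>R x)) =
          ennreal (r ^ (2*N)) * (ennreal (h x) * indicator (cball 0 1) x)"
          using hom nn r by (auto simp: homogeneous_def ennreal_mult split: split_indicator)
      qed
      also have "\<dots> = ennreal (r ^ (2*N)) * ennreal C"
        by (subst nn_integral_cmult) (measurable, simp add: CI)
      also have "ennreal (r ^ DIM('a)) * \<dots> = ennreal (C * (r ^ DIM('a) * r ^ (2 * N)))"
        using r C by (simp add: ennreal_mult[symmetric] mult_ac)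
      also have "r ^ DIM('a) * r ^ (2 * N) = t powr a"
        using r True unfolding r_def a_def power_add[symmetric]
        by (simp add: powr_half_sqrt[symmetric] powr_powr powr_realpow[symmetric]
          add_divide_distrib)
      finally show ?thesis using 1 True by simp
    qed
  qed
  show "emeasure (distr (density lborel h) borel (\<lambda>x. x \<bullet> x)) X =
      emeasure (density lborel (\<lambda>t. ennreal (C * a * (if 0 < t then t powr (a - 1) else 0)))) X"
    if "X \<in> range atMost" for X
  proof -
    from that obtain t where X: "X = {..t}" by auto
    have "emeasure (density lborel (\<lambda>t. ennreal (C * a * (if 0 < t then t powr (a - 1) else 0))))
        {..t} =
      (\<integral>\<^sup>+x. ennreal (C * a) * (ennreal (if 0 < x then x powr (a - 1) else 0) * indicator {..t} x)
        \<partial>lborel)"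
      using C a by (subst emeasure_density)
        (auto simp: ennreal_mult mult_ac intro!: nn_integral_cong)
    also have "\<dots> = ennreal (C * a) *
        (\<integral>\<^sup>+x. (ennreal (if 0 < x then x powr (a - 1) else 0) * indicator {..t} x) \<partial>lborel)"
      by (subst nn_integral_cmult) auto
    also have "\<dots> = ennreal (if t > 0 then C * t powr a else 0)"
    proof (cases "t > 0")
      case True
      then show ?thesis using a C nn_integral_powr_from_0[of a t]
        by (simp add: ennreal_mult[symmetric])
    next
      case False
      then have "(\<lambda>x. (ennreal (if 0 < x then x powr (a - 1) else 0) * indicator {..t} x)) =
          (\<lambda>_. 0)"
        by (auto split: split_indicator)
      then show ?thesis using False by simp
    qed
    finally show ?thesis using fin[of t] X by simp
  qed
  show "sets (distr (density lborel h) borel (\<lambda>x. x \<bullet> x)) = sigma_sets UNIV (range atMost)"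
    by (simp add: borel_eq_atMost)
  show "sets (density lborel (\<lambda>t. ennreal (C * a * (if 0 < t then t powr (a - 1) else 0)))) =
      sigma_sets UNIV (range atMost)"
    by (simp add: borel_eq_atMost)
  show "(\<Union>i. {..real i}) = UNIV" by (auto intro: real_arch_simple)
  show "emeasure (distr (density lborel h) borel (\<lambda>x. x \<bullet> x)) {..real i} \<noteq> \<infinity>" for i
    unfolding fin by simp
qed auto

text \<open>\<open>distr_homogeneous\<close> moves the integral to the half-line, with density C a
  t^(a-1). Nonnegativity lets h serve as a density; it is lifted in
  \<open>has_bochner_integral_polar\<close>.\<close>

lemma has_bochner_integral_homogeneous_radial:
  fixes h :: "'a::euclidean_space \<Rightarrow> real"
  assumes hom: "homogeneous (2 * N) h" and nn: "\<And>x. h x \<ge> 0"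
  assumes [measurable]: "g \<in> borel_measurable borel" and gnn: "\<And>t. g t \<ge> 0"
  assumes J: "has_bochner_integral lborel
      (\<lambda>t. (if 0 < t then t powr (DIM('a) / 2 + N - 1) else 0) * g t) J"
  shows "has_bochner_integral lborel (\<lambda>x. h x * g (x \<bullet> x))
    ((LINT x:cball 0 1|lborel. h x) * (DIM('a) / 2 + N) * J)"
proof (rule has_bochner_integral_nn_integral)
  define a where "a = DIM('a) / 2 + N"
  define C where "C = (LINT x:cball 0 1|lborel. h x)"
  have a: "a > 0" by (simp add: a_def add_pos_nonneg)
  note [measurable] = homogeneous_measurable[OF hom]
  have C: "C \<ge> 0" unfolding C_def set_lebesgue_integral_def
    using nn by (intro integral_nonneg_AE) auto
  have J0: "J \<ge> 0"
    using has_bochner_integral_integral_eq[OF J] gnn by (auto intro!: integral_nonneg_AE)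
  then show "0 \<le> (LINT x:cball 0 1|lborel. h x) * (DIM('a) / 2 + N) * J"
    using a C by (simp add: a_def C_def)
  show "(\<lambda>x. h x * g (x \<bullet> x)) \<in> borel_measurable lborel" by measurable
  show "AE x in lborel. 0 \<le> h x * g (x \<bullet> x)" using nn gnn by auto
  have "(\<integral>\<^sup>+x. ennreal (h x * g (x \<bullet> x)) \<partial>lborel) =
      (\<integral>\<^sup>+t. ennreal (g t) \<partial>distr (density lborel h) borel (\<lambda>x. x \<bullet> x))"
    using nn gnn by (simp add: nn_integral_distr nn_integral_density ennreal_mult)
  also have "\<dots> = (\<integral>\<^sup>+t. ennreal (C * a) *
      ennreal ((if 0 < t then t powr (a - 1) else 0) * g t) \<partial>lborel)"
    unfolding distr_homogeneous[OF hom nn] C_def[symmetric] a_def[symmetric]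
    using C a gnn by (auto simp: nn_integral_density ennreal_mult mult_ac
      intro!: nn_integral_cong)
  also have "\<dots> = ennreal (C * a) * (\<integral>\<^sup>+t. ennreal ((if 0 < t then t powr (a - 1) else 0) *
      g t) \<partial>lborel)"
    by (subst nn_integral_cmult) auto
  also have "(\<integral>\<^sup>+t. ennreal ((if 0 < t then t powr (a - 1) else 0) * g t) \<partial>lborel) = ennreal J"
    using J gnn unfolding a_def by (subst nn_integral_eq_integral)
      (auto simp: has_bochner_integral_iff)
  finally show "(\<integral>\<^sup>+x. ennreal (h x * g (x \<bullet> x)) \<partial>lborel) =
      ennreal ((LINT x:cball 0 1|lborel. h x) * (DIM('a) / 2 + N) * J)"
    using C a J0 by (simp add: ennreal_mult a_def C_def mult_ac)
qed

text \<open>\<open>sphere_measure\<close> is an image of Lebesgue measure on the punctured unit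
  ball, so the integral becomes one of h(x/|x|) = h(x) |x|^(-2N) over the ball. This is again
  homogeneous times radial, and the previous lemma applies. The radial integral is that of t^(d/2-1)
  over (0, 1], i.e. 2/d; the factor d in \<open>sphere_measure\<close> cancels its
  denominator.\<close>

lemma has_bochner_integral_sphere_homogeneous:
  fixes h :: "'a::euclidean_space \<Rightarrow> real"
  assumes hom: "homogeneous (2 * N) h" and nn: "\<And>x. h x \<ge> 0"
  shows "has_bochner_integral sphere_measure h
    (2 * ((LINT x:cball 0 1|lborel. h x) * (DIM('a) / 2 + N)))"
proof (rule has_bochner_integral_nn_integral)
  define C where "C = (LINT x:cball 0 1|lborel. h x)"
  \<comment> \<open>The radial factor |x|^(-2N) as a function of t = |x|^2, cut off outside the
    punctured unit ball.\<close>
  define g where "g t = (if 0 < t \<and> t \<le> 1 then t powr (- real N) else 0)" for t :: real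
  note h_meas [measurable] = homogeneous_measurable[OF hom]
  have g_meas [measurable]: "g \<in> borel_measurable borel" unfolding g_def by measurable
  have gnn: "g t \<ge> 0" for t by (simp add: g_def)
  have C: "C \<ge> 0" unfolding C_def set_lebesgue_integral_def
    using nn by (intro integral_nonneg_AE) auto
  then show "0 \<le> 2 * ((LINT x:cball 0 1|lborel. h x) * (DIM('a) / 2 + N))"
    by (simp add: C_def)
  have h_restrict: "h \<in> borel_measurable (restrict_space borel (sphere 0 1))"
    by (rule measurable_restrict_space1) measurable
  then show "h \<in> borel_measurable sphere_measure"
    unfolding sphere_measure_def by
      (subst measurable_cong_sets[of _ "restrict_space borel (sphere 0 1)" borel borel]) auto
  show "AE x in sphere_measure. 0 \<le> h x" using nn by simp
  have J: "has_bochner_integral lborel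
      (\<lambda>t. (if 0 < t then t powr (DIM('a) / 2 + N - 1) else 0) * g t) (2 / DIM('a))"
  proof (rule has_bochner_integral_nn_integral)
    have "(\<integral>\<^sup>+t. ennreal ((if 0 < t then t powr (DIM('a) / 2 + N - 1) else 0) * g t) \<partial>lborel) =
       (\<integral>\<^sup>+t. ennreal (if 0 < t then t powr (DIM('a) / 2 - 1) else 0) * indicator {..1} t
         \<partial>lborel)"
      by (intro nn_integral_cong) (auto simp: g_def powr_add[symmetric] split: split_indicator)
    also have "\<dots> = ennreal (2 / DIM('a))" 
      by (subst nn_integral_powr_from_0) auto
    finally show "(\<integral>\<^sup>+t. ennreal ((if 0 < t then t powr (DIM('a) / 2 + N - 1) else 0) *
        g t) \<partial>lborel) = ennreal (2 / DIM('a))" .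
  qed (auto simp: gnn)
  have *: "has_bochner_integral lborel (\<lambda>x. h x * g (x \<bullet> x)) (C * (DIM('a) / 2 + N) *
      (2 / DIM('a)))"
    unfolding C_def by (rule has_bochner_integral_homogeneous_radial[OF hom nn g_meas gnn J])
  have "(\<integral>\<^sup>+u. ennreal (h u) \<partial>sphere_measure) =
      of_nat DIM('a) * (\<integral>\<^sup>+x. ennreal (h (x /\<^sub>R norm x)) \<partial>restrict_space lborel
        (cball 0 1 - {0}))"
    unfolding sphere_measure_def
    using measurable_compose[OF h_restrict measurable_ennreal]
    by (simp add: nn_integral_scale_measure nn_integral_distr[OF normalize_measurable])
  also have "(\<integral>\<^sup>+x. ennreal (h (x /\<^sub>R norm x)) \<partial>restrict_space lborel (cball 0 1 - {0})) =
      (\<integral>\<^sup>+x. ennreal (h x * g (x \<bullet> x)) \<partial>lborel)"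
  proof (subst nn_integral_restrict_space, simp, intro nn_integral_cong)
    fix x :: 'a
    show "ennreal (h (x /\<^sub>R norm x)) * indicator (cball 0 1 - {0}) x = ennreal (h x * g (x \<bullet> x))"
    proof (cases "x \<in> cball 0 1 - {0}")
      case True
      then have x: "norm x > 0" "norm x \<le> 1" by auto
      then have "h (x /\<^sub>R norm x) = inverse (norm x) ^ (2 * N) * h x"
        using hom by (simp add: homogeneous_def)
      also have "inverse (norm x) ^ (2 * N) = g (x \<bullet> x)"
        using x by (simp add: g_def power2_norm_eq_inner[symmetric] abs_square_le_1 powr_minus
          powr_realpow power_inverse power_mult)
      finally show ?thesis using True by (simp add: mult_ac)
    next
      case False
      then have "\<not> (0 < x \<bullet> x \<and> x \<bullet> x \<le> 1)"
        by (auto simp: power2_norm_eq_inner[symmetric] abs_square_le_1)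
      then show ?thesis using False by (auto simp: g_def)
    qed
  qed
  also have "\<dots> = ennreal (C * (DIM('a) / 2 + N) * (2 / DIM('a)))"
    using nn_integral_eq_integral[of lborel "\<lambda>x. h x * g (x \<bullet> x)"] * nn gnn
      by (simp add: has_bochner_integral_iff)
  also have "of_nat DIM('a) * \<dots> = ennreal (2 * (C * (DIM('a) / 2 + N)))"
    using C by (simp add: ennreal_of_nat_eq_real_of_nat ennreal_mult[symmetric] field_simps)
  finally show "(\<integral>\<^sup>+u. ennreal (h u) \<partial>sphere_measure) =
      ennreal (2 * ((LINT x:cball 0 1|lborel. h x) * (DIM('a) / 2 + N)))"
    by (simp add: C_def)
qed

lemma homogeneous_max_0: "homogeneous N h \<Longrightarrow> homogeneous N (\<lambda>x. max (h x) 0)"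
  unfolding homogeneous_def
  by (auto intro!: continuous_on_max continuous_on_const simp: max_mult_distrib_left)

lemma homogeneous_minus: "homogeneous N h \<Longrightarrow> homogeneous N (\<lambda>x. - h x)"
  unfolding homogeneous_def by (auto intro!: continuous_intros)

text \<open>The two preceding lemmas contain the same ball integral times d/2 + N; eliminating it
  leaves half the sphere integral. The 1/2 is the one from r dr = dt/2 with t = r^2. Signs are
  handled by positive and negative parts, which keep the degree of homogeneity.\<close>

proposition has_bochner_integral_polar:
  fixes h :: "'a::euclidean_space \<Rightarrow> real"
  assumes hom: "homogeneous (2 * N) h"
  assumes g: "g \<in> borel_measurable borel" "\<And>t. g t \<ge> 0"
  assumes J: "has_bochner_integral lborel
      (\<lambda>t. (if 0 < t then t powr (DIM('a) / 2 + N - 1) else 0) * g t) J"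
  shows "has_bochner_integral lborel (\<lambda>x. h x * g (x \<bullet> x)) ((\<integral>u. h u \<partial>sphere_measure) / 2 * J)"
proof -
  have nonneg: "has_bochner_integral lborel (\<lambda>x. f x * g (x \<bullet> x)) ((\<integral>u. f u \<partial>sphere_measure) / 2 *
      J)
      \<and> integrable sphere_measure f"
    if "homogeneous (2 * N) f" "\<And>x. f x \<ge> 0" for f :: "'a \<Rightarrow> real"
    using has_bochner_integral_homogeneous_radial[OF that g J]
      has_bochner_integral_sphere_homogeneous[OF that]
    by (simp add: has_bochner_integral_iff)
  define p n where "p = (\<lambda>x. max (h x) 0)" and "n = (\<lambda>x. max (- h x) 0)"
  have p: "has_bochner_integral lborel (\<lambda>x. p x * g (x \<bullet> x)) ((\<integral>u. p u \<partial>sphere_measure) / 2 * J)"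
      "integrable sphere_measure p"
    using nonneg[of p] homogeneous_max_0[OF hom] by (auto simp: p_def)
  have n: "has_bochner_integral lborel (\<lambda>x. n x * g (x \<bullet> x)) ((\<integral>u. n u \<partial>sphere_measure) / 2 * J)"
      "integrable sphere_measure n"
    using nonneg[of n] homogeneous_max_0[OF homogeneous_minus[OF hom]] by (auto simp: n_def)
  have h: "h = (\<lambda>x. p x - n x)" by (auto simp: p_def n_def)
  have "has_bochner_integral lborel (\<lambda>x. p x * g (x \<bullet> x) - n x * g (x \<bullet> x))
      ((\<integral>u. p u \<partial>sphere_measure) / 2 * J - (\<integral>u. n u \<partial>sphere_measure) / 2 * J)"
    using p(1) n(1) by (rule has_bochner_integral_diff)
  moreover have "(\<integral>u. h u \<partial>sphere_measure) =
      (\<integral>u. p u \<partial>sphere_measure) - (\<integral>u. n u \<partial>sphere_measure)"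
    unfolding h using p(2) n(2) by (rule Bochner_Integration.integral_diff)
  moreover have "(\<lambda>x. p x * g (x \<bullet> x) - n x * g (x \<bullet> x)) = (\<lambda>x. h x * g (x \<bullet> x))"
    by (simp add: h left_diff_distrib)
  ultimately show ?thesis by (simp add: left_diff_distrib diff_divide_distrib)
qed

section \<open>Power series of products of negative binomials\<close>

unbundle no vec_syntax and fps_syntax

lemma sum_list_map_concat:
  "(\<Sum>x\<leftarrow>concat xss. f x) = (\<Sum>xs\<leftarrow>xss. \<Sum>x\<leftarrow>xs. f x :: 'a::comm_monoid_add)"
  by (induction xss) auto

text \<open>The index list does not depend on F, so that integrating such a coefficient reduces to
  integrating products of functions of one coordinate each.\<close>

lemma fps_prod_nth_list:
  assumes "finite S"
  shows "\<exists>hs. \<forall>F :: 'i \<Rightarrow> real fps. (\<Prod>i\<in>S. F i) $ m = (\<Sum>h\<leftarrow>hs. \<Prod>i\<in>S. F i $ h i)"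
  using assms
proof (induction S arbitrary: m)
  case empty
  show ?case
  proof (cases "m = 0")
    case True
    then show ?thesis by (intro exI[of _ "[\<lambda>_. 0]"]) simp
  next
    case False
    then show ?thesis by (intro exI[of _ "[]"]) simp
  qed
next
  case (insert x S)
  then obtain hs where hs: "\<And>m F. (\<Prod>i\<in>S. F i :: real fps) $ m = (\<Sum>h\<leftarrow>hs m. \<Prod>i\<in>S. F i $ h i)"
    by metis
  show ?case
  proof (intro exI allI)
    fix F :: "'i \<Rightarrow> real fps"
    have "(\<Prod>i\<in>S. F i $ (h(x := r)) i) = (\<Prod>i\<in>S. F i $ h i)" for h r
      using insert.hyps by (intro prod.cong) auto
    then have "(\<Sum>h\<leftarrow>concat (map (\<lambda>r. map (\<lambda>h. h(x := r)) (hs (m - r))) [0..<Suc m]).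
        \<Prod>i\<in>insert x S. F i $ h i)
      = (\<Sum>r\<leftarrow>[0..<Suc m]. F x $ r * (\<Sum>h\<leftarrow>hs (m - r). \<Prod>i\<in>S. F i $ h i))"
      using insert.hyps by (simp add: sum_list_map_concat o_def sum_list_const_mult del: upt_Suc)
    also have "\<dots> = (\<Sum>r=0..m. F x $ r * (\<Prod>i\<in>S. F i) $ (m - r))"
      by (simp add: hs interv_sum_list_conv_sum_set_nat atLeast0LessThan lessThan_Suc_atMost
        atLeast0AtMost del: upt_Suc)
    also have "\<dots> = (\<Prod>i\<in>insert x S. F i) $ m"
      using insert.hyps by (simp add: fps_mult_nth)
    finally show "(\<Prod>i\<in>insert x S. F i) $ m =
      (\<Sum>h\<leftarrow>concat (map (\<lambda>r. map (\<lambda>h. h(x := r)) (hs (m - r))) [0..<Suc m]).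
        \<Prod>i\<in>insert x S. F i $ h i)" ..
  qed
qed

text \<open>Read at the m-th coefficient and combined with \<open>fps_prod_nth_list\<close>, this is
  the multinomial theorem for the m-th power of a sum divided by m!.\<close>

lemma fps_exp_sum: "finite S \<Longrightarrow> (\<Prod>i\<in>S. fps_exp (t i)) = fps_exp (\<Sum>i\<in>S. t i :: real)"
  by (induction S rule: finite_induct) (simp_all add: fps_exp_add_mult)

text \<open>The formal series of (1 - a X)^(-q).\<close>

definition neg_binomial_fps :: "real \<Rightarrow> real \<Rightarrow> real fps" where
  "neg_binomial_fps q a = Abs_fps (\<lambda>m. pochhammer q m / fact m * a ^ m)"

text \<open>The last series is q a X / (1 - a X). Multiplying by L = 1 - a X reduces the claim to
  the differential equation L B' = q a B, a two-term relation between coefficients; L is nonzero and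
  can be cancelled again.\<close>

lemma neg_binomial_fps_log_deriv:
  "fps_X * fps_deriv (neg_binomial_fps q a) =
    neg_binomial_fps q a * Abs_fps (\<lambda>m. if m = 0 then 0 else q * a ^ m)"
proof -
  let ?B = "neg_binomial_fps q a" and ?G = "Abs_fps (\<lambda>m. if m = 0 then 0 else q * a ^ m)"
  let ?L = "1 - fps_const a * fps_X :: real fps"
  have B: "?L * fps_deriv ?B = fps_const (q * a) * ?B"
  proof (rule fps_ext)
    fix n
    have d: "fps_deriv ?B $ n = (q + n) * a * ?B $ n" for n
      by (simp add: neg_binomial_fps_def pochhammer_Suc field_simps del: of_nat_Suc)
    show "(?L * fps_deriv ?B) $ n = (fps_const (q * a) * ?B) $ n"
    proof (cases n)
      case (Suc k)
      have "(?L * fps_deriv ?B) $ n = fps_deriv ?B $ n - a * fps_deriv ?B $ k"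
        by (simp add: Suc left_diff_distrib mult.assoc del: fps_deriv_nth)
      also have "a * fps_deriv ?B $ k = a * (n * ?B $ n)"
        by (simp add: Suc)
      also have "fps_deriv ?B $ n = (q + n) * a * ?B $ n" by (rule d)
      finally show ?thesis by (simp add: algebra_simps)
    next
      case 0
      then show ?thesis using d[of 0] by (simp add: left_diff_distrib mult.assoc)
    qed
  qed
  have G: "?L * ?G = fps_const (q * a) * fps_X"
  proof (rule fps_ext)
    fix n show "(?L * ?G) $ n = (fps_const (q * a) * fps_X) $ n"
      by (cases n; cases "n - 1") (auto simp: left_diff_distrib mult.assoc)
  qed
  have "?L * (fps_X * fps_deriv ?B) = ?L * (?B * ?G)"
  proof -
    have "?L * (fps_X * fps_deriv ?B) = fps_X * (?L * fps_deriv ?B)"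
      by (simp only: mult_ac)
    also have "\<dots> = ?B * (?L * ?G)"
      unfolding B G by (simp only: mult_ac)
    also have "\<dots> = ?L * (?B * ?G)"
      by (simp only: mult_ac)
    finally show ?thesis .
  qed
  moreover have "?L $ 0 \<noteq> 0" by simp
  then have "?L \<noteq> 0" by (metis fps_zero_nth)
  ultimately show ?thesis by simp
qed

text \<open>Logarithmic derivatives add up over a product. Writing them as B G instead of a quotient
  avoids any invertibility condition.\<close>

lemma fps_prod_log_deriv:
  fixes B G :: "'i \<Rightarrow> real fps"
  assumes "finite S" "\<And>i. i \<in> S \<Longrightarrow> fps_X * fps_deriv (B i) = B i * G i"
  shows "fps_X * fps_deriv (\<Prod>i\<in>S. B i) = (\<Prod>i\<in>S. B i) * (\<Sum>i\<in>S. G i)"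
  using assms
proof (induction S rule: finite_induct)
  case (insert x S)
  have "fps_X * fps_deriv (B x * (\<Prod>i\<in>S. B i)) =
      B x * (fps_X * fps_deriv (\<Prod>i\<in>S. B i)) + (fps_X * fps_deriv (B x)) * (\<Prod>i\<in>S. B i)"
    by (simp add: algebra_simps)
  then show ?case using insert by (simp add: algebra_simps)
qed simp

lemma neg_binomial_fps_prod_recursion:
  fixes q a :: "'i::finite \<Rightarrow> real"
  defines "c \<equiv> fps_nth (\<Prod>i\<in>UNIV. neg_binomial_fps (q i) (a i))"
  shows "real m * c m = (\<Sum>r<m. (\<Sum>i\<in>UNIV. q i * a i ^ (m - r)) * c r)"
proof -
  let ?P = "\<Prod>i\<in>UNIV. neg_binomial_fps (q i) (a i)"
  let ?G = "\<lambda>i. Abs_fps (\<lambda>m. if m = 0 then 0 else q i * a i ^ m)"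
  have "fps_X * fps_deriv ?P = ?P * (\<Sum>i\<in>UNIV. ?G i)"
    by (rule fps_prod_log_deriv) (auto intro: neg_binomial_fps_log_deriv)
  then have "(fps_X * fps_deriv ?P) $ m = (?P * (\<Sum>i\<in>UNIV. ?G i)) $ m" by simp
  also have "(fps_X * fps_deriv ?P) $ m = real m * c m"
    by (cases m) (simp_all add: c_def)
  also have "(?P * (\<Sum>i\<in>UNIV. ?G i)) $ m =
      (\<Sum>r=0..m. c r * (\<Sum>i\<in>UNIV. if m - r = 0 then 0 else q i * a i ^ (m - r)))"
    by (simp add: fps_mult_nth c_def fps_sum_nth)
  \<comment> \<open>The term r = m vanishes because the logarithmic derivatives have no constant
    term; this makes the relation a recursion.\<close>
  also have "\<dots> = (\<Sum>r<m. c r * (\<Sum>i\<in>UNIV. if m - r = 0 then 0 else q i * a i ^ (m - r)))"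
    by (rule sum.mono_neutral_right) auto
  also have "\<dots> = (\<Sum>r<m. (\<Sum>i\<in>UNIV. q i * a i ^ (m - r)) * c r)"
    by (intro sum.cong) (auto simp: mult.commute)
  finally show ?thesis .
qed

text \<open>Newton's series for (1 + w)^(-q) at w = -a z: the sign in
  \<open>gbinomial_pochhammer\<close> cancels against the one in w^m. Absolute convergence is
  recorded because these series are later multiplied.\<close>

lemma neg_binomial_fps_sums:
  fixes z :: complex
  assumes "norm (of_real a * z) < 1"
  shows "(\<lambda>m. of_real (neg_binomial_fps q a $ m) * z ^ m) sums
      (1 - of_real a * z) powr (- of_real q)"
    and "summable (\<lambda>m. norm (of_real (neg_binomial_fps q a $ m) * z ^ m))"
proof -
  define w where "w = - (of_real a * z)"
  have eq: "of_real (neg_binomial_fps q a $ m) * z ^ m =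
      ((- of_real q :: complex) gchoose m) * w ^ m" for m
  proof -
    have "w ^ m = (-1) ^ m * (of_real a ^ m * z ^ m)"
      unfolding w_def by (simp add: power_minus' power_mult_distrib power_minus[of "of_real a *
          z"])
    moreover have "((-1) ^ m * (-1) ^ m :: complex) = 1"
      by (simp flip: power_mult_distrib)
    ultimately show ?thesis
      by (simp add: neg_binomial_fps_def gbinomial_pochhammer pochhammer_of_real mult_ac)
  qed
  have w: "norm w < 1" using assms by (simp add: w_def)
  show "(\<lambda>m. of_real (neg_binomial_fps q a $ m) * z ^ m) sums
      (1 - of_real a * z) powr (- of_real q)"
    using gen_binomial_complex[OF w, of "- of_real q"] unfolding eq by (simp add: w_def)
  \<comment> \<open>The power series also converges at the point K, which has larger modulus, so it
    converges absolutely at w.\<close>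
  obtain K where K: "norm w < K" "K < 1" using w dense by blast
  then have "norm (of_real K :: complex) < 1" "norm w < norm (of_real K :: complex)"
    using norm_ge_zero[of w] by (auto simp del: norm_ge_zero)
  then show "summable (\<lambda>m. norm (of_real (neg_binomial_fps q a $ m) * z ^ m))"
    unfolding eq using gen_binomial_complex[of "of_real K" "- of_real q"]
      by (blast intro: powser_insidea sums_summable)
qed

text \<open>The Cauchy product theorem needs absolute convergence of both factors, so the induction
  carries it along with the value.\<close>

lemma fps_prod_sums:
  fixes F :: "'i \<Rightarrow> real fps" and z :: complex
  assumes "finite S"
    and "\<And>i. i \<in> S \<Longrightarrow> (\<lambda>m. of_real (F i $ m) * z ^ m) sums f i"
    and "\<And>i. i \<in> S \<Longrightarrow> summable (\<lambda>m. norm (of_real (F i $ m) * z ^ m))"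
  shows "(\<lambda>m. of_real ((\<Prod>i\<in>S. F i) $ m) * z ^ m) sums (\<Prod>i\<in>S. f i) \<and>
    summable (\<lambda>m. norm (of_real ((\<Prod>i\<in>S. F i) $ m) * z ^ m))"
  using assms
proof (induction S rule: finite_induct)
  case empty
  have "(\<lambda>m. of_real ((1 :: real fps) $ m) * z ^ m) = (\<lambda>m. if m = 0 then 1 else 0)"
    by (auto simp: fun_eq_iff)
  moreover have "(\<lambda>m. norm (of_real ((1 :: real fps) $ m) * z ^ m)) =
      (\<lambda>m. if m = 0 then 1 else 0)"
    by (auto simp: fun_eq_iff)
  ultimately show ?case
    using sums_single[of 0 "\<lambda>_. 1::complex"] sums_single[of 0 "\<lambda>_. 1::real"]
      by (auto simp: sums_iff)
next
  case (insert x S)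
  let ?a = "\<lambda>m. of_real (F x $ m) * z ^ m" and ?b = "\<lambda>m. of_real ((\<Prod>i\<in>S. F i) $ m) * z ^ m"
  have a: "?a sums f x" "summable (\<lambda>m. norm (?a m))" using insert by auto
  have b: "?b sums (\<Prod>i\<in>S. f i)" "summable (\<lambda>m. norm (?b m))" using insert by auto
  have eq: "of_real ((\<Prod>i\<in>insert x S. F i) $ m) * z ^ m = (\<Sum>i\<le>m. ?a i * ?b (m - i))" for m
  proof -
    have "of_real ((\<Prod>i\<in>insert x S. F i) $ m) * z ^ m =
        (\<Sum>i\<le>m. (of_real (F x $ i) * of_real ((\<Prod>i\<in>S. F i) $ (m - i))) * z ^ m)"
      using insert.hyps by (simp add: fps_mult_nth atLeast0AtMost sum_distrib_right)
    also have "\<dots> = (\<Sum>i\<le>m. ?a i * ?b (m - i))"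
    proof (rule sum.cong[OF refl])
      fix i assume "i \<in> {..m}"
      then have "z ^ m = z ^ i * z ^ (m - i)"
        by (simp flip: power_add)
      then show "(of_real (F x $ i) * of_real ((\<Prod>i\<in>S. F i) $ (m - i))) * z ^ m =
          ?a i * ?b (m - i)"
        by (simp only: mult_ac)
    qed
    finally show ?thesis .
  qed
  have "(\<lambda>m. \<Sum>i\<le>m. ?a i * ?b (m - i)) sums ((\<Sum>k. ?a k) * (\<Sum>k. ?b k))"
    by (rule Cauchy_product_sums[OF a(2) b(2)])
  moreover have "summable (\<lambda>m. norm (\<Sum>i\<le>m. ?a i * ?b (m - i)))"
  proof (rule summable_comparison_test')
    show "summable (\<lambda>m. \<Sum>i\<le>m. norm (?a i) * norm (?b (m - i)))"
      using Cauchy_product_sums[of "\<lambda>m. norm (?a m)" "\<lambda>m. norm (?b m)"] a(2) b(2)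
        by (auto simp: sums_iff)
    show "norm (norm (\<Sum>i\<le>m. ?a i * ?b (m - i))) \<le> (\<Sum>i\<le>m. norm (?a i) * norm (?b (m - i)))"
      if "0 \<le> m" for m
      by (simp only: norm_mult[symmetric] real_norm_def abs_norm_cancel) (rule norm_sum)
  qed
  ultimately show ?case using a(1) b(1) insert.hyps unfolding eq by (simp add: sums_iff)
qed

unbundle no fps_syntax and vec_syntax

section \<open>Chi-square and Gaussian integrals\<close>

text \<open>The substitution t = x/2 in Euler's integral for Gamma(n/2). The value 1 later removes
  the distribution function from the coefficients; its finiteness also permits passing from
  \<open>emeasure\<close> to \<open>measure\<close>.\<close>

lemma emeasure_chi_square_UNIV:
  assumes n: "n > 0"
  shows "emeasure (chi_square n) UNIV = 1"
proof -
  define a where "a = real n / 2"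
  have a: "a > 0" using n by (simp add: a_def)
  have G: "Gamma a > 0" using a by (rule Gamma_real_pos)
  define f where "f t = ennreal (if 0 < t then t powr (a - 1) / exp t else 0)" for t :: real
  define d where "d x = ennreal (if 0 < x then x powr (a - 1) *
      exp (- x / 2) / (2 powr a * Gamma a) else 0)" for x :: real
  have [measurable]: "f \<in> borel_measurable borel" unfolding f_def by measurable
  have [measurable]: "d \<in> borel_measurable borel" unfolding d_def by measurable
  have "(\<integral>\<^sup>+t. f t \<partial>lborel) = (\<integral>\<^sup>+t. ennreal (t powr (a - 1) / exp t) *
      indicator {0..} t \<partial>lborel)"
    by (intro nn_integral_cong_AE AE_I[of _ _ "{0}"])
      (auto simp: f_def split: split_indicator if_splits)
  also have "\<dots> = ennreal (Gamma a)"
    using Gamma_integral_real[OF a] by (intro nn_integral_has_integral_lebesgue') auto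
  finally have "ennreal (Gamma a) = (\<integral>\<^sup>+t. f t \<partial>lborel)" ..
  also have "\<dots> = ennreal (1 / 2) * (\<integral>\<^sup>+x. f (x / 2) \<partial>lborel)"
    using nn_integral_lborel_scaleR[of f "1/2"] by simp
  also have "(\<lambda>x. f (x / 2)) = (\<lambda>x. ennreal (2 * Gamma a) * d x)"
  proof
    fix x :: real
    show "f (x / 2) = ennreal (2 * Gamma a) * d x"
    proof (cases "x > 0")
      case True
      have "(x / 2) powr (a - 1) / exp (x / 2) =
          2 * Gamma a * (x powr (a - 1) * exp (- x / 2) / (2 powr a * Gamma a))"
        using True G by (simp add: powr_divide powr_diff exp_minus field_simps)
      then show ?thesis using True G by (simp add: f_def d_def ennreal_mult[symmetric])
    qed (simp add: f_def d_def)
  qed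
  also have "ennreal (1 / 2) * (\<integral>\<^sup>+x. ennreal (2 * Gamma a) * d x \<partial>lborel) =
      ennreal (1 / 2) * (ennreal (2 * Gamma a) * (\<integral>\<^sup>+x. d x \<partial>lborel))"
    by (subst nn_integral_cmult) auto
  also have "\<dots> = ennreal (Gamma a) * (\<integral>\<^sup>+x. d x \<partial>lborel)"
    using G ennreal_mult[of "1 / 2" "2 * Gamma a"] by (simp add: mult.assoc[symmetric])
  finally have "ennreal (Gamma a) * (\<integral>\<^sup>+x. d x \<partial>lborel) = ennreal (Gamma a) * 1" by simp
  then have "(\<integral>\<^sup>+x. d x \<partial>lborel) = 1"
    using G by (subst (asm) ennreal_mult_cancel_left) (auto simp: ennreal_eq_0_iff)
  then show ?thesis
    unfolding chi_square_def d_def a_def by (simp add: emeasure_density)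
qed

text \<open>The substitution t = s u turns the integrand into a multiple of the chi-square density.
  \<open>A\<close> is kept general so that a half-line yields the distribution function and
  \<open>UNIV\<close> the total mass.\<close>

lemma has_bochner_integral_chi_square:
  assumes n: "n > 0" and s: "s > 0" and A[measurable]: "A \<in> sets borel"
  shows "has_bochner_integral lborel
    (\<lambda>t. (if 0 < t then t powr (real n / 2 - 1) else 0) *
      (exp (- t / (2 * s)) * indicator A (t / s)))
    ((2 * s) powr (real n / 2) * Gamma (real n / 2) * measure (chi_square n) A)"
proof (rule has_bochner_integral_nn_integral)
  define a where "a = real n / 2"
  have a: "a > 0" using n by (simp add: a_def)
  have G: "Gamma a > 0" using a by (rule Gamma_real_pos)
  define F where "F t = (if 0 < t then t powr (a - 1) else 0) *
      (exp (- t / (2 * s)) * indicator A (t / s))" for t :: real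
  define d where "d x = ennreal (if 0 < x then x powr (a - 1) *
      exp (- x / 2) / (2 powr a * Gamma a) else 0)" for x :: real
  have [measurable]: "F \<in> borel_measurable borel" unfolding F_def by measurable
  have [measurable]: "d \<in> borel_measurable borel" unfolding d_def by measurable
  have chi: "chi_square n = density lborel d"
    unfolding chi_square_def d_def a_def ..
  have "emeasure (chi_square n) A \<le> emeasure (chi_square n) UNIV"
    by (rule emeasure_mono) (auto simp: chi)
  then have fin: "emeasure (chi_square n) A \<noteq> \<infinity>"
    using emeasure_chi_square_UNIV[OF n] by (auto simp: top_unique)
  have "(\<integral>\<^sup>+t. ennreal (F t) \<partial>lborel) = ennreal s * (\<integral>\<^sup>+u. ennreal (F (s * u)) \<partial>lborel)"
    using nn_integral_lborel_scaleR[of "\<lambda>t. ennreal (F t)" s] s by simp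
  also have "(\<lambda>u. ennreal (F (s * u))) =
      (\<lambda>u. ennreal (s powr (a - 1) * (2 powr a * Gamma a)) * (d u * indicator A u))"
  proof
    fix u :: real
    show "ennreal (F (s * u)) = ennreal (s powr (a - 1) * (2 powr a * Gamma a)) *
        (d u * indicator A u)"
      using s G by (cases "u \<in> A"; cases "u > 0")
        (simp_all add: F_def d_def ennreal_mult[symmetric] powr_mult zero_less_mult_iff)
  qed
  also have "ennreal s * (\<integral>\<^sup>+u. ennreal (s powr (a - 1) * (2 powr a * Gamma a)) *
      (d u * indicator A u) \<partial>lborel)
      = ennreal s * (ennreal (s powr (a - 1) * (2 powr a * Gamma a)) * emeasure (chi_square n) A)"
    by (subst nn_integral_cmult) (auto simp: chi emeasure_density)
  also have "\<dots> = ennreal (s * (s powr (a - 1) * (2 powr a * Gamma a)) * measure (chi_square n) A)"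
    using fin s G by (simp add: emeasure_eq_ennreal_measure ennreal_mult[symmetric] mult.assoc)
  also have "s * (s powr (a - 1) * (2 powr a * Gamma a)) = (2 * s) powr a * Gamma a"
    using s by (simp add: powr_mult powr_diff)
  finally show "(\<integral>\<^sup>+t. ennreal ((if 0 < t then t powr (real n / 2 - 1) else 0) *
      (exp (- t / (2 * s)) * indicator A (t / s))) \<partial>lborel) =
     ennreal ((2 * s) powr (real n / 2) * Gamma (real n / 2) * measure (chi_square n) A)"
    unfolding F_def a_def .
  show "0 \<le> (2 * s) powr (real n / 2) * Gamma (real n / 2) * measure (chi_square n) A"
    using G by (simp add: a_def)
qed (use A in \<open>auto intro!: AE_I2\<close>)

section \<open>Product integrals over R^v and one-dimensional Gaussian moments\<close>

lemma has_bochner_integral_lborel_prod_vec: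
  fixes f :: "'n::finite \<Rightarrow> real \<Rightarrow> real"
  assumes f: "\<And>i. has_bochner_integral lborel (f i) (J i)" and nn: "\<And>i y. f i y \<ge> 0"
  shows "has_bochner_integral lborel (\<lambda>x :: real^'n. \<Prod>i\<in>UNIV. f i (x$i)) (\<Prod>i\<in>UNIV. J i)"
proof (rule has_bochner_integral_nn_integral)
  have [measurable]: "f i \<in> borel_measurable borel" for i
    using f[of i] by (auto dest: borel_measurable_has_bochner_integral)
  have J: "J i \<ge> 0" for i
    unfolding has_bochner_integral_integral_eq[OF f[of i], symmetric]
    by (intro integral_nonneg_AE AE_I2 nn)
  then show "0 \<le> (\<Prod>i\<in>UNIV. J i)" by (intro prod_nonneg) auto
  have nni: "(\<integral>\<^sup>+y. ennreal (f i y) \<partial>lborel) = ennreal (J i)" for i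
    using f[of i] nn by (subst nn_integral_eq_integral) (auto simp: has_bochner_integral_iff)
  \<comment> \<open>\<open>nn_integral_lborel_prod\<close> is indexed by basis vectors;
    \<open>ix\<close> recovers the coordinate from \<open>axis i 1\<close>.\<close>
  define ix where "ix b = (SOME i. b = axis i (1::real))" for b :: "real^'n"
  have ix: "ix (axis i 1) = i" for i
    by (simp add: ix_def axis_eq_axis)
  have Basis: "(Basis :: (real^'n) set) = range (\<lambda>i. axis i 1)"
    by (auto simp: Basis_vec_def)
  have inj: "inj (\<lambda>i::'n. axis i (1::real))"
    by (auto simp: inj_on_def axis_eq_axis)
  have "(\<integral>\<^sup>+x. ennreal (\<Prod>i\<in>UNIV. f i (x$i)) \<partial>(lborel :: (real^'n) measure)) =
     (\<integral>\<^sup>+x. (\<Prod>b\<in>Basis. ennreal (f (ix b) (x \<bullet> b))) \<partial>(lborel :: (real^'n) measure))"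
    unfolding Basis by (subst prod.reindex[OF inj])
      (simp add: ix cart_eq_inner_axis prod_ennreal nn)
  also have "\<dots> = (\<Prod>b\<in>(Basis :: (real^'n) set). \<integral>\<^sup>+y. ennreal (f (ix b) y) \<partial>lborel)"
    by (rule nn_integral_lborel_prod) auto
  also have "\<dots> = ennreal (\<Prod>i\<in>UNIV. J i)"
    unfolding Basis by (subst prod.reindex[OF inj]) (simp add: ix nni prod_ennreal J)
  finally show "(\<integral>\<^sup>+x. ennreal (\<Prod>i\<in>UNIV. f i (x$i)) \<partial>(lborel :: (real^'n) measure)) =
      ennreal (\<Prod>i\<in>UNIV. J i)" .
  show "(\<lambda>x :: real^'n. \<Prod>i\<in>UNIV. f i (x$i)) \<in> borel_measurable lborel"
    by measurable
  show "AE x :: real^'n in lborel. 0 \<le> (\<Prod>i\<in>UNIV. f i (x$i))"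
    by (intro AE_I2 prod_nonneg) (auto simp: nn)
qed

text \<open>Both sides are the double factorial (2q-1)!!, the normalised Gaussian moment. The
  Pochhammer form is the one that splits when the exponent is a sum.\<close>

lemma fact_double_pochhammer: "fact (2 * q) / (2 ^ q * fact q) =
    2 ^ q * pochhammer (1 / 2 :: real) q"
  unfolding fact_double by (simp add: mult_2 power_add)

lemma has_bochner_integral_gauss_moment:
  assumes s: "s > 0"
  shows "has_bochner_integral lborel (\<lambda>y. y ^ (2 * q) * exp (- y\<^sup>2 / (2 * s)))
     (sqrt (2 * pi * s) * ((2 * s) ^ q * pochhammer (1 / 2) q))"
proof -
  have "has_bochner_integral lborel (\<lambda>y. sqrt (2 * pi * s) *
      (normal_density 0 (sqrt s) y * (y - 0) ^ (2 * q)))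
     (sqrt (2 * pi * s) * (fact (2 * q) / ((2 / (sqrt s)\<^sup>2) ^ q * fact q)))"
    using s by (intro has_bochner_integral_mult_right normal_moment_even) simp
  also have "(\<lambda>y. sqrt (2 * pi * s) * (normal_density 0 (sqrt s) y * (y - 0) ^ (2 * q))) =
      (\<lambda>y. y ^ (2 * q) * exp (- y\<^sup>2 / (2 * s)))"
    using s by (simp add: normal_density_def mult.commute)
  also have "fact (2 * q) / ((2 / (sqrt s)\<^sup>2) ^ q * fact q) =
      s ^ q * (fact (2 * q) / (2 ^ q * fact q))"
    using s by (simp add: power_divide)
  also have "\<dots> = (2 * s) ^ q * pochhammer (1 / 2) q"
    unfolding fact_double_pochhammer by (simp add: power_mult_distrib)
  finally show ?thesis .
qed

section \<open>The expanded Gaussian integrand\<close>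

lemma diag_mat_mult: "diag_mat a ** diag_mat b = diag_mat (\<chi> i. a$i * b$i)"
  by (simp add: diag_mat_def matrix_matrix_mult_def vec_eq_iff if_distrib[of "\<lambda>t. t * _"] cong:
    if_cong)

lemma diag_mat_mult_vec: "(diag_mat a *v x) $ i = a$i * x$i"
  by (simp add: diag_mat_def matrix_vector_mult_def if_distrib[of "\<lambda>t. t * _"] cong: if_cong)

lemma det_diag_mat: "det (diag_mat lam) = (\<Prod>i\<in>UNIV. lam$i)"
  by (subst det_diagonal) (auto simp: diag_mat_def)

lemma matrix_inv_diag_mat:
  assumes "\<And>i. lam$i \<noteq> 0"
  shows "matrix_inv (diag_mat lam) = diag_mat (\<chi> i. 1 / lam$i)"
proof -
  let ?D = "diag_mat (\<chi> i. 1 / lam$i)"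
  have I: "diag_mat lam ** ?D = mat 1" "?D ** diag_mat lam = mat 1"
    unfolding diag_mat_mult using assms by (simp_all add: diag_mat_def mat_def vec_eq_iff)
  have "diag_mat lam ** matrix_inv (diag_mat lam) =
      mat 1 \<and> matrix_inv (diag_mat lam) ** diag_mat lam = mat 1"
    unfolding matrix_inv_def by (rule someI[of _ ?D]) (simp add: I)
  then show ?thesis
    by (metis I(2) matrix_mul_assoc matrix_mul_lid matrix_mul_rid)
qed

lemma Q_form_eq:
  assumes "\<And>i. lam$i \<noteq> 0"
  shows "Q_form s lam x = (\<Sum>i\<in>UNIV. (1 / lam$i - 1 / s) * (x$i)\<^sup>2)"
proof -
  have eq: "((matrix_inv (diag_mat lam) - (1 / s) *\<^sub>R mat 1) *v x) $ i =
      (1 / lam$i - 1 / s) * x$i" for i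
    using matrix_inv_diag_mat[OF assms]
    by (simp add: matrix_vector_mult_diff_rdistrib diag_mat_mult_vec
      scaleR_matrix_vector_assoc[symmetric] left_diff_distrib)
  then show ?thesis
    unfolding Q_form_def inner_vec_def eq by (intro sum.cong) (simp_all add: power2_eq_square)
qed

definition even_monomial :: "('n::finite \<Rightarrow> nat) \<Rightarrow> real^'n \<Rightarrow> real" where
  "even_monomial p x = (\<Prod>i\<in>UNIV. (x$i) ^ (2 * p i))"

text \<open>With v = \<open>CARD('n)\<close> and d = \<open>sum p UNIV\<close>, the factor
  \<open>2 ^ d * pochhammer (v/2 + m) d\<close> is (v+2m)(v+2m+2)...(v+2m+2d-2). It comes from
  Gamma(v/2+m+d) / Gamma(v/2+m) and the 2^d in (2s)^(v/2+m+d). For d = 1 and d = 2 it is the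
  numerator in \<open>coeff1\<close> and \<open>coeff2\<close>.\<close>

definition moment_coeff :: "real \<Rightarrow> real^'n \<Rightarrow> ('n \<Rightarrow> nat) \<Rightarrow> nat \<Rightarrow> real" where
  "moment_coeff s lam p m =
     (\<Prod>i\<in>UNIV. (s / lam$i) ^ p i)
     * (2 ^ sum p UNIV * pochhammer (real CARD('n) / 2 + real m) (sum p UNIV) / fact m)
     * (s powr (real CARD('n) / 2 + real m) / sqrt (det (diag_mat lam)))
     * (Gamma (real CARD('n) / 2 + real m) / Gamma (real CARD('n) / 2))
     * sphere_mean (\<lambda>u. (- Q_form s lam u) ^ m * even_monomial p u)"

definition moment_alpha :: "real \<Rightarrow> real^'n \<Rightarrow> ('n \<Rightarrow> nat) \<Rightarrow> real" where
  "moment_alpha \<rho> lam p = (LINT x:square_ball \<rho>|lborel.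
     (\<Prod>i\<in>UNIV. ((x$i)\<^sup>2 / lam$i) ^ p i) * (\<Prod>n\<in>UNIV. gauss_delta (x$n) (lam$n)))"

definition moment_term :: "real \<Rightarrow> real^'n \<Rightarrow> ('n \<Rightarrow> nat) \<Rightarrow> nat \<Rightarrow> real^'n \<Rightarrow> real" where
  "moment_term s lam p m x =
     (\<Prod>i\<in>UNIV. (1 / lam$i) ^ p i / sqrt (2 * pi * lam$i))
     * (even_monomial p x * exp (- (x \<bullet> x) / (2 * s))) * ((- Q_form s lam x / 2) ^ m / fact m)"

lemma moment_term_sums:
  fixes lam :: "real^'n"
  assumes lam: "\<And>i. lam$i > 0" and s: "s > 0"
  shows "(\<lambda>m. moment_term s lam p m x) sums
    ((\<Prod>i\<in>UNIV. ((x$i)\<^sup>2 / lam$i) ^ p i) * (\<Prod>n\<in>UNIV. gauss_delta (x$n) (lam$n)))"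
proof -
  let ?w = "(\<Prod>i\<in>UNIV. (1 / lam$i) ^ p i / sqrt (2 * pi * lam$i))
     * (even_monomial p x * exp (- (x \<bullet> x) / (2 * s)))"
  have lam0: "lam$i \<noteq> 0" for i using lam[of i] by simp
  have "(\<lambda>m. (- Q_form s lam x / 2) ^ m / fact m) sums exp (- Q_form s lam x / 2)"
  proof -
    have "y ^ m / fact m = y ^ m /\<^sub>R fact m" for y :: real and m
      by (simp add: field_simps)
    then show ?thesis by (simp only: exp_converges)
  qed
  then have "(\<lambda>m. moment_term s lam p m x) sums (?w * exp (- Q_form s lam x / 2))"
    unfolding moment_term_def by (rule sums_mult)
  also have "?w * exp (- Q_form s lam x / 2) =
      (\<Prod>i\<in>UNIV. (1 / lam$i) ^ p i / sqrt (2 * pi * lam$i)) * even_monomial p x *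
      exp (- (x \<bullet> x) / (2 * s) + - Q_form s lam x / 2)"
    by (simp only: exp_add mult.assoc)
  also have "- (x \<bullet> x) / (2 * s) + - Q_form s lam x / 2 =
      (\<Sum>i\<in>UNIV. - (x$i)\<^sup>2 / (2 * s) + - ((1 / lam$i - 1 / s) * (x$i)\<^sup>2) / 2)"
    unfolding Q_form_eq[OF lam0] inner_vec_def
    by (simp only: sum.distrib sum_divide_distrib[symmetric] sum_negf power2_eq_square
      inner_real_def)
  also have "\<dots> = (\<Sum>i\<in>UNIV. - ((x$i)\<^sup>2 / (2 * lam$i)))"
    using s lam0 by (intro sum.cong refl) (simp add: field_simps)
  also have "exp \<dots> = (\<Prod>i\<in>UNIV. exp (- ((x$i)\<^sup>2 / (2 * lam$i))))"
    by (rule exp_sum) simp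
  also have "(\<Prod>i\<in>UNIV. (1 / lam$i) ^ p i / sqrt (2 * pi * lam$i)) * even_monomial p x * \<dots> =
     (\<Prod>i\<in>UNIV. ((x$i)\<^sup>2 / lam$i) ^ p i) * (\<Prod>n\<in>UNIV. gauss_delta (x$n) (lam$n))"
    unfolding even_monomial_def gauss_delta_def
    by (simp only: prod.distrib[symmetric], intro prod.cong)
       (simp_all add: power_mult power_divide)
  finally show ?thesis .
qed

lemma homogeneous_Q_form_monomial:
  fixes lam :: "real^'n"
  assumes lam0: "\<And>i. lam$i \<noteq> 0"
  shows "homogeneous (2 * (m + sum p UNIV)) (\<lambda>x. (- Q_form s lam x) ^ m * even_monomial p x)"
  unfolding homogeneous_def
proof (intro conjI allI impI)
  show "continuous_on UNIV (\<lambda>x. (- Q_form s lam x) ^ m * even_monomial p x)"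
    unfolding Q_form_eq[OF lam0] even_monomial_def by (intro continuous_intros)
  fix r :: real and x :: "real^'n" assume "r > 0"
  have "Q_form s lam (r *\<^sub>R x) = r\<^sup>2 * Q_form s lam x"
    unfolding Q_form_eq[OF lam0] by (simp add: sum_distrib_left power_mult_distrib mult_ac)
  then have "(- Q_form s lam (r *\<^sub>R x)) ^ m = r ^ (2 * m) * (- Q_form s lam x) ^ m"
    by (simp only: mult_minus_right[symmetric] power_mult_distrib power_mult)
  moreover have "even_monomial p (r *\<^sub>R x) = r ^ (2 * sum p UNIV) * even_monomial p x"
    unfolding even_monomial_def by (simp add: power_mult_distrib prod.distrib power_sum[symmetric]
      sum_distrib_left)
  ultimately show "(- Q_form s lam (r *\<^sub>R x)) ^ m * even_monomial p (r *\<^sub>R x) =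
     r ^ (2 * (m + sum p UNIV)) * ((- Q_form s lam x) ^ m * even_monomial p x)"
    by (simp only: add_mult_distrib2 power_add mult_ac)
qed

lemma prod_normalisation:
  fixes lam :: "real^'n"
  assumes lam: "\<And>i. lam$i > 0"
  shows "(\<Prod>i\<in>UNIV. 1 / sqrt (2 * pi * lam$i)) =
      1 / ((2 * pi) powr (real CARD('n) / 2) * sqrt (det (diag_mat lam)))"
proof -
  have "(\<Prod>i\<in>UNIV. 1 / sqrt (2 * pi * lam$i)) =
      1 / ((\<Prod>i\<in>(UNIV::'n set). sqrt (2 * pi)) * (\<Prod>i\<in>UNIV. sqrt (lam$i)))"
    by (simp add: prod_dividef real_sqrt_mult prod.distrib power_mult_distrib)
  also have "(\<Prod>i\<in>(UNIV::'n set). sqrt (2 * pi)) = (2 * pi) powr (real CARD('n) / 2)"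
    by (simp add: powr_half_sqrt[symmetric] powr_powr powr_realpow[symmetric])
  also have "(\<Prod>i\<in>UNIV. sqrt (lam$i)) = sqrt (det (diag_mat lam))"
    unfolding det_diag_mat using lam
    by (simp add: powr_half_sqrt[symmetric] prod_powr_distrib less_imp_le prod_nonneg)
  finally show ?thesis .
qed

text \<open>The polynomial part has degree 2(m+d), so the polar formula leaves t^(v/2+m+d-1)
  exp(-t/2s) on the half-line, a chi-square density in t/s with v + 2(m+d) degrees of freedom. The
  half-line case gives the series, the case \<open>A = UNIV\<close> evaluates the
  coefficients.\<close>

lemma has_bochner_integral_moment_term:
  fixes lam :: "real^'n"
  assumes lam: "\<And>i. lam$i > 0" and s: "s > 0" and A[measurable]: "A \<in> sets borel"
  shows "has_bochner_integral lborel (\<lambda>x. moment_term s lam p m x * indicator A ((x \<bullet> x) / s))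
    (moment_coeff s lam p m * measure (chi_square (CARD('n) + 2 * (m + sum p UNIV))) A)"
proof -
  have lam0: "lam$i \<noteq> 0" for i using lam[of i] by simp
  define d where "d = sum p UNIV"
  define v where "v = real CARD('n) / 2"
  have v: "v > 0" by (simp add: v_def)
  define n where "n = CARD('n) + 2 * (m + d)"
  define \<kappa> where "\<kappa> = measure (chi_square n) A"
  define K where "K = (\<Prod>i\<in>UNIV. (1 / lam$i) ^ p i / sqrt (2 * pi * lam$i))"
  define L where "L = (\<Prod>i\<in>UNIV. (1 / lam$i) ^ p i)"
  define D where "D = sqrt (det (diag_mat lam))"
  define h where "h = (\<lambda>x :: real^'n. (- Q_form s lam x) ^ m * even_monomial p x)"
  define I where "I = (\<integral>u. h u \<partial>sphere_measure)"
  have D: "D > 0" using lam by (simp add: D_def det_diag_mat prod_pos)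
  have n: "n > 0" "real n / 2 = v + m + d" by (simp_all add: n_def v_def)
  have K: "K = L / ((2 * pi) powr v * D)"
    using prod_normalisation[OF lam] unfolding K_def L_def D_def v_def
    by (simp add: prod_dividef)
  have e: "real n / 2 - 1 = real DIM(real^'n) / 2 + real (m + d) - 1"
    by (simp add: n v_def)
  have "has_bochner_integral lborel
     (\<lambda>t. (if 0 < t then t powr (real DIM(real^'n) / 2 + real (m + d) - 1) else 0) *
       (exp (- t / (2 * s)) * indicator A (t / s)))
     ((2 * s) powr (v + m + d) * Gamma (v + m + d) * \<kappa>)"
    using has_bochner_integral_chi_square[OF n(1) s A] unfolding e unfolding n(2) \<kappa>_def .
  then have "has_bochner_integral lborel
      (\<lambda>x. h x * (exp (- (x \<bullet> x) / (2 * s)) * indicator A ((x \<bullet> x) / s)))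
     (I / 2 * ((2 * s) powr (v + m + d) * Gamma (v + m + d) * \<kappa>))"
    using homogeneous_Q_form_monomial[OF lam0, of m p s] unfolding I_def h_def d_def
    by (intro has_bochner_integral_polar) auto
  then have "has_bochner_integral lborel (\<lambda>x. K / (2 ^ m * fact m) *
      (h x * (exp (- (x \<bullet> x) / (2 * s)) * indicator A ((x \<bullet> x) / s))))
     (K / (2 ^ m * fact m) * (I / 2 * ((2 * s) powr (v + m + d) * Gamma (v + m + d) * \<kappa>)))"
    by (rule has_bochner_integral_mult_right)
  also have "(\<lambda>x. K / (2 ^ m * fact m) *
      (h x * (exp (- (x \<bullet> x) / (2 * s)) * indicator A ((x \<bullet> x) / s)))) =
      (\<lambda>x. moment_term s lam p m x * indicator A ((x \<bullet> x) / s))"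
    unfolding moment_term_def K_def[symmetric] h_def unfolding power_divide by (simp add: mult_ac)
  also have "K / (2 ^ m * fact m) * (I / 2 * ((2 * s) powr (v + m + d) * Gamma (v + m + d) * \<kappa>)) =
     moment_coeff s lam p m * \<kappa>"
  proof -
    have 1: "(2 * s) powr (v + m + d) = 2 powr v * 2 ^ m * 2 ^ d * (s powr (v + m) * s ^ d)"
      using s by (simp add: powr_add powr_mult powr_realpow)
    have "v + m \<notin> \<int>\<^sub>\<le>\<^sub>0" using v by (auto dest!: nonpos_Ints_nonpos)
    then have 2: "Gamma (v + m + d) = pochhammer (v + m) d * Gamma (v + m)"
      using v by (subst pochhammer_Gamma) (auto simp: Gamma_eq_zero_iff)
    have 3: "(\<Prod>i\<in>UNIV. (s / lam$i) ^ p i) = L * s ^ d"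
      by (simp add: L_def d_def power_divide prod_dividef power_sum)
    have 4: "(2 * pi) powr v = 2 powr v * pi powr v" by (simp add: powr_mult)
    have Gv: "Gamma v > 0" using v by (rule Gamma_real_pos)
    have 5: "moment_coeff s lam p m = L * s ^ d * (2 ^ d * pochhammer (v + m) d / fact m) *
      (s powr (v + m) / D) * (Gamma (v + m) / Gamma v) * (Gamma v / (2 * pi powr v) * I)"
      unfolding moment_coeff_def sphere_mean_def 3 d_def[symmetric] v_def[symmetric]
        D_def[symmetric] h_def[symmetric] I_def[symmetric] ..
    \<comment> \<open>Only cancellation remains, stated for opaque reals: w = 2^v, t = pi^v, M =
      2^m, f = m!, e = 2^d, S = s^(v+m), r = s^d, P the Pochhammer factor, G = Gamma(v+m) and g =
      Gamma(v), where v now denotes half the dimension.\<close>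
    have "L / (w * t * D) / (M * f) * (I / 2 * (w * M * e * (S * r) * (P * G) * \<kappa>)) =
        L * r * (e * P / f) * (S / D) * (G / g) * (g / (2 * t) * I) * \<kappa>"
      if "w \<noteq> 0" "t \<noteq> 0" "M \<noteq> 0" "f \<noteq> 0" "g \<noteq> 0" for w t M f e S r P G g :: real
      using that D by (simp add: mult_ac)
    note rearrange = this
    show ?thesis unfolding 1 2 5 K 4 by (rule rearrange) (use Gv in auto)
  qed
  finally show ?thesis unfolding \<kappa>_def n_def d_def .
qed

section \<open>Series representation and moments\<close>

lemma moment_term_eq_0: "moment_term s lam p m x =
    moment_term s lam p 0 x * ((- Q_form s lam x / 2) ^ m / fact m)"
  by (simp add: moment_term_def)

lemma moment_term_0_nonneg: "(\<And>i. lam$i > 0) \<Longrightarrow> moment_term s lam p 0 x \<ge> 0"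
  unfolding moment_term_def even_monomial_def
  by (auto intro!: mult_nonneg_nonneg prod_nonneg divide_nonneg_nonneg simp: less_imp_le
    power_mult)

lemma abs_Q_form_le:
  assumes lam0: "\<And>i. lam$i \<noteq> 0"
  shows "\<bar>Q_form s lam x\<bar> \<le> (\<Sum>i\<in>UNIV. \<bar>1 / lam$i - 1 / s\<bar>) * (x \<bullet> x)"
proof -
  have "\<bar>Q_form s lam x\<bar> \<le> (\<Sum>i\<in>UNIV. \<bar>(1 / lam$i - 1 / s) * (x$i)\<^sup>2\<bar>)"
    unfolding Q_form_eq[OF lam0] by (rule sum_abs)
  also have "\<dots> \<le> (\<Sum>i\<in>UNIV. \<bar>1 / lam$i - 1 / s\<bar> * (x \<bullet> x))"
  proof (intro sum_mono)
    fix i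
    have "(x$i)\<^sup>2 \<le> x \<bullet> x"
      using power_mono[OF component_le_norm_cart[of x i], of 2]
        by (simp add: power2_norm_eq_inner)
    then show "\<bar>(1 / lam$i - 1 / s) * (x$i)\<^sup>2\<bar> \<le> \<bar>1 / lam$i - 1 / s\<bar> * (x \<bullet> x)"
      by (simp add: abs_mult mult_left_mono)
  qed
  finally show ?thesis by (simp add: sum_distrib_right)
qed

text \<open>On a bounded ball Q is bounded, which separates the variables: x enters the majorant
  only through the zeroth term, m only through a numerical exponential series.\<close>

lemma moment_term_bound:
  assumes lam: "\<And>i. lam$i > 0" and x: "x \<bullet> x \<le> R"
  shows "\<bar>moment_term s lam p m x\<bar> \<le>
    moment_term s lam p 0 x * (((\<Sum>i\<in>UNIV. \<bar>1 / lam$i - 1 / s\<bar>) * R / 2) ^ m / fact m)"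
proof -
  have lam0: "lam$i \<noteq> 0" for i using lam[of i] by simp
  have "\<bar>Q_form s lam x\<bar> \<le> (\<Sum>i\<in>UNIV. \<bar>1 / lam$i - 1 / s\<bar>) * R"
    by (rule order_trans[OF abs_Q_form_le[OF lam0]]) (auto intro!: mult_left_mono x sum_nonneg)
  then have "\<bar>(- Q_form s lam x / 2) ^ m / fact m\<bar> \<le>
      ((\<Sum>i\<in>UNIV. \<bar>1 / lam$i - 1 / s\<bar>) * R / 2) ^ m / fact m"
    by (auto simp: abs_divide power_abs intro!: divide_right_mono power_mono)
  then show ?thesis
    unfolding moment_term_eq_0[of s lam p m] abs_mult
    using moment_term_0_nonneg[OF lam, of s p x]
      by (simp only: abs_of_nonneg) (rule mult_left_mono)
qed

text \<open>For all r <= R the terms are dominated by the integrable zeroth term times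
  \<open>b R m\<close>, which is summable and free of x and r. This justifies integrating termwise
  and, after integration, feeds the Weierstrass M-test on all of \<open>{..R}\<close>.\<close>

lemma moment_series:
  fixes lam :: "real^'n" and p :: "'n \<Rightarrow> nat"
  assumes lam: "\<And>i. lam$i > 0" and s: "s > 0"
  defines "f \<equiv> \<lambda>m r. moment_coeff s lam p m *
      chi_square_cdf (CARD('n) + 2 * (m + sum p UNIV)) (r / s)"
  shows "(\<lambda>m. f m r) sums moment_alpha r lam p"
    and "uniform_limit {..R} (\<lambda>N r. \<Sum>m<N. f m r) (\<lambda>r. moment_alpha r lam p) sequentially"
proof -
  define T where "T r m x = moment_term s lam p m x * indicator {..r / s} ((x \<bullet> x) / s)" for r m
    and x :: "real^'n"
  define W where "W = (\<integral>x. moment_term s lam p 0 x \<partial>lborel)"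
  \<comment> \<open>The absolute value keeps the majorant nonnegative also for R < 0, where the
    balls are empty.\<close>
  define b where "b R m = ((\<Sum>i\<in>UNIV. \<bar>1 / lam$i - 1 / s\<bar>) * \<bar>R\<bar> / 2) ^ m / fact m" for R :: real
    and m
  have b_summable: "summable (b R)" for R
  proof -
    have "inverse (fact m) * y ^ m = y ^ m / fact m" for y :: real and m
      by (simp add: field_simps)
    from this[symmetric] show ?thesis unfolding b_def by (simp only: summable_exp)
  qed
  have T_hbi: "has_bochner_integral lborel (T r m) (f m r)" for r m
    using has_bochner_integral_moment_term[OF lam s, of "{..r / s}" p m]
    unfolding T_def f_def cdf_def by simp
  have T_int: "integrable lborel (T r m)" "integral\<^sup>L lborel (T r m) = f m r" for r m
    using T_hbi[of r m] by (auto simp: has_bochner_integral_iff)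
  have T0_int: "integrable lborel (moment_term s lam p 0)"
    using has_bochner_integral_moment_term[OF lam s, of UNIV p 0]
      by (simp add: has_bochner_integral_iff)
  have T_bound: "norm (T r m x) \<le> moment_term s lam p 0 x * b R m" if "r \<le> R" for r R m x
  proof (cases "x \<bullet> x \<le> r")
    case True
    then show ?thesis
      using moment_term_bound[OF lam, of x "\<bar>R\<bar>" s p m] that s
      by (simp add: T_def b_def divide_le_cancel)
  next
    case False
    then show ?thesis using s moment_term_0_nonneg[OF lam, of s p x]
      by (auto simp: T_def b_def divide_le_cancel intro!: mult_nonneg_nonneg divide_nonneg_nonneg
        zero_le_power sum_nonneg)
  qed
  have T_norm: "(\<integral>x. norm (T r m x) \<partial>lborel) \<le> W * b R m" if "r \<le> R" for r R m
  proof -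
    have "(\<integral>x. norm (T r m x) \<partial>lborel) \<le> (\<integral>x. moment_term s lam p 0 x * b R m \<partial>lborel)"
      using T_int(1)[of r m] T0_int T_bound[OF that] by (intro integral_mono) auto
    then show ?thesis by (simp add: W_def)
  qed
  have f_bound: "norm (f m r) \<le> W * b R m" if "r \<le> R" for r R m
    using T_norm[OF that, of m] integral_norm_bound[of lborel "T r m"] T_int(2)[of r m] by simp
  have Wb: "summable (\<lambda>m. W * b R m)" for R
    by (rule summable_mult[OF b_summable])
  show sums: "(\<lambda>m. f m r) sums moment_alpha r lam p" for r
  proof -
    have "(\<lambda>m. integral\<^sup>L lborel (T r m)) sums (\<integral>x. (\<Sum>m. T r m x) \<partial>lborel)"
    proof (rule sums_integral)
      show "AE x in lborel. summable (\<lambda>m. norm (T r m x))"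
      proof (rule AE_I2)
        fix x
        show "summable (\<lambda>m. norm (T r m x))"
          by (rule summable_comparison_test'[OF summable_mult[OF b_summable[of r], of "moment_term
              s lam p 0 x"]])
             (use T_bound[of r r] in auto)
      qed
      show "summable (\<lambda>m. \<integral>x. norm (T r m x) \<partial>lborel)"
        by (rule summable_comparison_test'[OF Wb[of r]])
           (use T_norm[of r r] in \<open>auto simp: integral_nonneg_AE\<close>)
    qed (rule T_int)
    moreover have "(\<Sum>m. T r m x) = indicator (square_ball r) x *\<^sub>R
       ((\<Prod>i\<in>UNIV. ((x$i)\<^sup>2 / lam$i) ^ p i) * (\<Prod>n\<in>UNIV. gauss_delta (x$n) (lam$n)))" for x
    proof -
      have "indicator {..r / s} ((x \<bullet> x) / s) = (indicator (square_ball r) x :: real)"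
        using s by (auto simp: square_ball_def indicator_def divide_le_cancel)
      then show ?thesis
        using sums_mult2[OF moment_term_sums[OF lam s, of p x], of "indicator (square_ball r) x"]
        by (simp add: T_def sums_iff mult.commute)
    qed
    ultimately show ?thesis
      by (simp add: T_int moment_alpha_def set_lebesgue_integral_def)
  qed
  have "uniform_limit {..R} (\<lambda>N r. \<Sum>m<N. f m r) (\<lambda>r. \<Sum>m. f m r) sequentially"
    by (rule Weierstrass_m_test[OF _ Wb[of R]]) (rule f_bound, simp)
  then show "uniform_limit {..R} (\<lambda>N r. \<Sum>m<N. f m r) (\<lambda>r. moment_alpha r lam p) sequentially"
    using sums by (simp add: sums_iff)
qed

lemma has_bochner_integral_sum_list:
  fixes f :: "'h \<Rightarrow> 'a \<Rightarrow> real"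
  assumes "\<And>h. has_bochner_integral M (f h) (J h)"
  shows "has_bochner_integral M (\<lambda>x. \<Sum>h\<leftarrow>hs. f h x) (\<Sum>h\<leftarrow>hs. J h)"
  by (induction hs) (auto intro!: has_bochner_integral_add assms)

text \<open>The whole-space integral of \<open>moment_term\<close> is computed twice: by polar
  coordinates it is the coefficient, by expansion into monomials a combination of products of
  one-dimensional moments. For fixed m the expansion is finite, so no convergence question
  arises.\<close>

lemma moment_coeff_eq:
  fixes lam :: "real^'n"
  assumes lam: "\<And>i. lam$i > 0" and s: "s > 0"
  shows "moment_coeff s lam p m =
    (\<Prod>i\<in>UNIV. sqrt (s / lam$i) * (s / lam$i) ^ p i * (2 ^ p i * pochhammer (1 / 2) (p i))) *
    fps_nth (\<Prod>i\<in>UNIV. neg_binomial_fps (1 / 2 + real (p i)) (1 - s / lam$i)) m"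
proof -
  have lam0: "lam$i \<noteq> 0" for i using lam[of i] by simp
  obtain hs where hs: "\<And>F :: 'n \<Rightarrow> real fps. fps_nth (\<Prod>i\<in>UNIV. F i) m =
      (\<Sum>h\<leftarrow>hs. \<Prod>i\<in>UNIV. fps_nth (F i) (h i))"
    using fps_prod_nth_list[of "UNIV :: 'n set" m] by auto
  define K where "K i = (1 / lam$i) ^ p i / sqrt (2 * pi * lam$i)" for i
  \<comment> \<open>All signs are collected in \<open>c\<close>, leaving the one-dimensional
    functions \<open>g\<close> nonnegative as the product integral requires.\<close>
  define c where "c i n = ((1 - s / lam$i) / (2 * s)) ^ n / fact n" for i n
  define g where "g q y = y ^ (2 * q) * exp (- y\<^sup>2 / (2 * s))" for q and y :: real
  have expansion: "moment_term s lam p m x =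
      (\<Sum>h\<leftarrow>hs. (\<Prod>i\<in>UNIV. K i * c i (h i)) * (\<Prod>i\<in>UNIV. g (p i + h i) (x$i)))" for x
  proof -
    define t where "t i = (1 - s / lam$i) / (2 * s) * (x$i)\<^sup>2" for i
    have "- Q_form s lam x / 2 = (\<Sum>i\<in>UNIV. t i)"
      unfolding Q_form_eq[OF lam0] t_def sum_negf[symmetric] sum_divide_distrib
      using s lam0 by (intro sum.cong) (auto simp: field_simps)
    then have "(- Q_form s lam x / 2) ^ m / fact m = fps_nth (\<Prod>i\<in>UNIV. fps_exp (t i)) m"
      by (simp add: fps_exp_sum)
    also have "\<dots> = (\<Sum>h\<leftarrow>hs. \<Prod>i\<in>UNIV. t i ^ h i / fact (h i))"
      by (simp add: hs)
    finally have 1: "(- Q_form s lam x / 2) ^ m / fact m =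
        (\<Sum>h\<leftarrow>hs. \<Prod>i\<in>UNIV. t i ^ h i / fact (h i))" .
    have "exp (- (x \<bullet> x) / (2 * s)) = (\<Prod>i\<in>UNIV. exp (- (x$i)\<^sup>2 / (2 * s)))"
      by (simp add: exp_sum[symmetric] inner_vec_def power2_eq_square sum_divide_distrib sum_negf)
    then have 2: "even_monomial p x * exp (- (x \<bullet> x) / (2 * s)) =
        (\<Prod>i\<in>UNIV. (x$i) ^ (2 * p i) * exp (- (x$i)\<^sup>2 / (2 * s)))"
      by (simp add: even_monomial_def prod.distrib)
    have 3: "K i * ((x$i) ^ (2 * p i) * exp (- (x$i)\<^sup>2 / (2 * s))) * (t i ^ h i / fact (h i)) =
        K i * c i (h i) * g (p i + h i) (x$i)" for h i
      unfolding t_def c_def g_def power_mult_distrib power_mult[symmetric] add_mult_distrib2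
        power_add
      by (simp add: mult_ac)
    show ?thesis
      unfolding moment_term_def 1 2 K_def[symmetric] sum_list_const_mult[symmetric]
      by (simp only: prod.distrib[symmetric] 3)
  qed
  let ?J = "\<lambda>h. (\<Prod>i\<in>UNIV. K i * c i (h i)) *
      (\<Prod>i\<in>UNIV. sqrt (2 * pi * s) * ((2 * s) ^ (p i + h i) * pochhammer (1 / 2) (p i + h i)))"
  have "has_bochner_integral lborel (moment_term s lam p m) (\<Sum>h\<leftarrow>hs. ?J h)"
    unfolding expansion
  proof (intro has_bochner_integral_sum_list has_bochner_integral_mult_right
    has_bochner_integral_lborel_prod_vec)
    show "has_bochner_integral lborel (g (p i + h i)) (sqrt (2 * pi * s) *
        ((2 * s) ^ (p i + h i) * pochhammer (1 / 2) (p i + h i)))" for h :: "'n \<Rightarrow> nat" and i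
      unfolding g_def by (rule has_bochner_integral_gauss_moment[OF s])
    show "g (p i + h i) y \<ge> 0" for h :: "'n \<Rightarrow> nat" and i y
      by (simp add: g_def zero_le_even_power)
  qed
  moreover have "has_bochner_integral lborel (moment_term s lam p m) (moment_coeff s lam p m)"
    using has_bochner_integral_moment_term[OF lam s, of UNIV p m]
    by (simp add: measure_def emeasure_chi_square_UNIV)
  ultimately have "moment_coeff s lam p m = (\<Sum>h\<leftarrow>hs. ?J h)"
    by (rule has_bochner_integral_eq[symmetric])
  also have "\<dots> = (\<Sum>h\<leftarrow>hs. (\<Prod>i\<in>UNIV. sqrt (s / lam$i) * (s / lam$i) ^ p i *
      (2 ^ p i * pochhammer (1 / 2) (p i))) *
      (\<Prod>i\<in>UNIV. fps_nth (neg_binomial_fps (1 / 2 + real (p i)) (1 - s / lam$i)) (h i)))"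
  proof -
    have "K i * c i n * (sqrt (2 * pi * s) * ((2 * s) ^ (p i + n) * pochhammer (1 / 2) (p i + n)))
        =
        sqrt (s / lam$i) * (s / lam$i) ^ p i * (2 ^ p i * pochhammer (1 / 2) (p i)) *
        fps_nth (neg_binomial_fps (1 / 2 + real (p i)) (1 - s / lam$i)) n" for i n
    proof -
      have "sqrt (2 * pi * s) = sqrt (s / lam$i) * sqrt (2 * pi * lam$i)"
        using lam[of i] by (simp add: real_sqrt_mult[symmetric])
      moreover have "sqrt (2 * pi * lam$i) \<noteq> 0" using lam[of i] by simp
      ultimately have 1: "K i * sqrt (2 * pi * s) = (1 / lam$i) ^ p i * sqrt (s / lam$i)"
        by (simp add: K_def)
      have 2: "c i n * (2 * s) ^ n = (1 - s / lam$i) ^ n / fact n"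
      proof -
        have "((1 - s / lam$i) / (2 * s)) ^ n * (2 * s) ^ n = (1 - s / lam$i) ^ n"
          using s by (simp only: power_mult_distrib[symmetric]) simp
        then show ?thesis by (simp only: c_def times_divide_eq_left)
      qed
      have 3: "(1 / lam$i) ^ p i * (2 * s) ^ p i = (s / lam$i) ^ p i * 2 ^ p i"
      proof -
        have "1 / lam$i * (2 * s) = s / lam$i * 2" by simp
        then show ?thesis by (simp only: power_mult_distrib[symmetric])
      qed
      \<comment> \<open>The origin of the parameter 1/2 + p_i: (1/2)_(p+n) = (1/2)_p (1/2+p)_n,
        where the first factor joins the constant in front and the second is the numerator of a
        negative binomial coefficient.\<close>
      have "K i * c i n * (sqrt (2 * pi * s) *
          ((2 * s) ^ (p i + n) * pochhammer (1 / 2) (p i + n))) =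
        (K i * sqrt (2 * pi * s)) * (c i n * (2 * s) ^ n) * (2 * s) ^ p i *
          (pochhammer (1 / 2) (p i) * pochhammer (1 / 2 + real (p i)) n)"
        by (simp only: power_add pochhammer_product' mult_ac)
      also have "\<dots> = sqrt (s / lam$i) * ((1 / lam$i) ^ p i * (2 * s) ^ p i) *
          pochhammer (1 / 2) (p i) *
          (pochhammer (1 / 2 + real (p i)) n * ((1 - s / lam$i) ^ n / fact n))"
        unfolding 1 2 by (simp only: mult_ac)
      also have "\<dots> = sqrt (s / lam$i) * (s / lam$i) ^ p i * (2 ^ p i * pochhammer (1 / 2) (p i)) *
        fps_nth (neg_binomial_fps (1 / 2 + real (p i)) (1 - s / lam$i)) n"
        unfolding 3 by (simp add: neg_binomial_fps_def)
      finally show ?thesis .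
    qed
    then show ?thesis by (simp only: prod.distrib[symmetric])
  qed
  finally show ?thesis by (simp only: hs sum_list_const_mult)
qed

section \<open>Coefficients, recursions and generating functions\<close>

lemma moment_coeff_0:
  fixes lam :: "real^'n"
  assumes lam: "\<And>i. lam$i > 0" and s: "s > 0"
  shows "moment_coeff s lam p 0 =
    (\<Prod>i\<in>UNIV. sqrt (s / lam$i) * (s / lam$i) ^ p i * (2 ^ p i * pochhammer (1 / 2) (p i)))"
proof -
  have "fps_nth (\<Prod>i\<in>S. F i) 0 = (\<Prod>i\<in>S. fps_nth (F i) 0)" for S and F :: "'n \<Rightarrow> real fps"
    by (induction S rule: infinite_finite_induct) auto
  then show ?thesis unfolding moment_coeff_eq[OF lam s] by (simp add: neg_binomial_fps_def)
qed

text \<open>The prefactor in \<open>moment_coeff_eq\<close> is independent of m and passes through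
  the linear recursion for the product of binomial series. Doubling the parameters 1/2 + p_i gives
  the integers 1 + 2 p_i, which are the values 1, 3, 5 of \<open>e1\<close> and \<open>e2\<close>,
  and puts the 2 into the denominator 2m.\<close>

lemma moment_coeff_recursion:
  fixes lam :: "real^'n"
  assumes lam: "\<And>i. lam$i > 0" and s: "s > 0" and m: "m \<ge> 1"
  shows "moment_coeff s lam p m = 1 / (2 * real m) *
    (\<Sum>r<m. (\<Sum>i\<in>UNIV. (1 + 2 * real (p i)) * (1 - s / lam$i) ^ (m - r)) * moment_coeff s lam p r)"
proof -
  define C where "C = (\<Prod>i\<in>UNIV. sqrt (s / lam$i) * (s / lam$i) ^ p i *
      (2 ^ p i * pochhammer (1 / 2) (p i)))"
  define c where "c = fps_nth (\<Prod>i\<in>UNIV. neg_binomial_fps (1 / 2 + real (p i)) (1 - s / lam$i))"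
  have eq: "moment_coeff s lam p m = C * c m" for m
    unfolding C_def c_def by (rule moment_coeff_eq[OF lam s])
  have half: "(\<Sum>i\<in>UNIV. (1 + 2 * real (p i)) * (1 - s / lam$i) ^ l) =
      2 * (\<Sum>i\<in>UNIV. (1 / 2 + real (p i)) * (1 - s / lam$i) ^ l)" for l
    by (simp add: sum_distrib_left mult.assoc[symmetric] distrib_left)
  have "real m * c m = (\<Sum>r<m. (\<Sum>i\<in>UNIV. (1 / 2 + real (p i)) * (1 - s / lam$i) ^ (m - r)) * c r)"
    unfolding c_def by (rule neg_binomial_fps_prod_recursion)
  then have "2 * C * (real m * c m) =
      (\<Sum>r<m. 2 * (\<Sum>i\<in>UNIV. (1 / 2 + real (p i)) * (1 - s / lam$i) ^ (m - r)) * (C * c r))"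
    by (simp add: sum_distrib_left mult_ac)
  then have "(\<Sum>r<m. (\<Sum>i\<in>UNIV. (1 + 2 * real (p i)) * (1 - s / lam$i) ^ (m - r)) *
      moment_coeff s lam p r) = 2 * real m * moment_coeff s lam p m"
    unfolding half eq by (simp only: mult_ac)
  then show ?thesis using m by simp
qed

lemma norm_less_gen_radius:
  assumes "ereal (norm z) < gen_radius s lam"
  shows "norm (of_real (1 - s / lam$i) * z :: complex) < 1"
proof (cases "1 - s / lam$i = 0")
  case False
  then have a: "\<bar>1 - s / lam$i\<bar> > 0" by simp
  have "gen_radius s lam \<le> inverse (ereal \<bar>1 - s / lam$i\<bar>)"
    unfolding gen_radius_def by (rule Min_le) auto
  also have "\<dots> = ereal (1 / \<bar>1 - s / lam$i\<bar>)"
    using a by (simp add: divide_inverse)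
  finally have "ereal (norm z) < ereal (1 / \<bar>1 - s / lam$i\<bar>)"
    using assms by (rule less_le_trans[rotated])
  then have "norm z < 1 / \<bar>1 - s / lam$i\<bar>"
    by (simp only: less_ereal.simps)
  then have "norm z * \<bar>1 - s / lam$i\<bar> < 1"
    using a by (simp only: pos_less_divide_eq)
  then show ?thesis by (simp only: norm_mult norm_of_real mult.commute)
next
  case True
  then show ?thesis by (simp only: of_real_0 mult_zero_left norm_zero)
qed

lemma moment_coeff_generating:
  fixes lam :: "real^'n" and z :: complex
  assumes lam: "\<And>i. lam$i > 0" and s: "s > 0" and z: "ereal (norm z) < gen_radius s lam"
  shows "(\<lambda>m. of_real (moment_coeff s lam p m) * z ^ m) sums
    (\<Prod>i\<in>UNIV. of_real (sqrt (s / lam$i) * (s / lam$i) ^ p i *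
      (2 ^ p i * pochhammer (1 / 2) (p i))) *
      (1 - of_real (1 - s / lam$i) * z) powr (- of_real (1 / 2 + real (p i))))"
proof -
  let ?F = "\<lambda>i. neg_binomial_fps (1 / 2 + real (p i)) (1 - s / lam$i)"
  have "(\<lambda>m. of_real (fps_nth (\<Prod>i\<in>UNIV. ?F i) m) * z ^ m) sums
      (\<Prod>i\<in>UNIV. (1 - of_real (1 - s / lam$i) * z) powr (- of_real (1 / 2 + real (p i))))"
    by (intro fps_prod_sums[THEN conjunct1] neg_binomial_fps_sums norm_less_gen_radius[OF z]
      finite)
  from sums_mult[OF this, of "of_real (\<Prod>i\<in>UNIV. sqrt (s / lam$i) * (s / lam$i) ^ p i *
      (2 ^ p i * pochhammer (1 / 2) (p i)))"]
  show ?thesis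
    unfolding moment_coeff_eq[OF lam s]
      by (simp only: of_real_mult of_real_prod mult.assoc prod.distrib)
qed

section \<open>Specialisation of the exponents to the two families of the theorem\<close>

lemma prod_power_delta:
  fixes f :: "'n::finite \<Rightarrow> 'a::comm_monoid_mult"
  shows "(\<Prod>i\<in>UNIV. f i ^ (if i = k then 1 else 0)) = f k"
  by (subst prod.remove[of _ k]) auto

lemma prod_power_two_deltas:
  fixes f :: "'n::finite \<Rightarrow> 'a::comm_monoid_mult"
  shows "(\<Prod>i\<in>UNIV. f i ^ ((if i = j then 1 else 0) + (if i = k then 1 else 0))) = f j * f k"
  by (simp only: power_add prod.distrib prod_power_delta)

definition delta1 :: "'n \<Rightarrow> 'n \<Rightarrow> nat" where
  "delta1 k i = (if i = k then 1 else 0)"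

text \<open>As a sum of two Kronecker symbols it takes the value 2 at k when j = k, so the diagonal
  and off-diagonal integrals share one argument.\<close>

definition delta2 :: "'n \<Rightarrow> 'n \<Rightarrow> 'n \<Rightarrow> nat" where
  "delta2 j k i = (if i = j then 1 else 0) + (if i = k then 1 else 0)"

lemma sum_delta1: "sum (delta1 k) UNIV = 1"
  for k :: "'n::finite"
  by (simp add: delta1_def)

lemma sum_delta2: "sum (delta2 j k) UNIV = 2"
  for k :: "'n::finite"
  by (simp add: delta2_def sum.distrib)

lemma even_monomial_delta1: "even_monomial (delta1 k) x = (x$k)\<^sup>2"
  unfolding even_monomial_def delta1_def power_mult by (rule prod_power_delta)

lemma even_monomial_delta2: "even_monomial (delta2 j k) x = (x$j)\<^sup>2 * (x$k)\<^sup>2"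
  unfolding even_monomial_def delta2_def power_mult by (rule prod_power_two_deltas)

lemma coeff1_eq: "coeff1 s lam k m = moment_coeff s lam (delta1 k) m"
  unfolding coeff1_def moment_coeff_def even_monomial_delta1 sum_delta1
  by (simp add: delta1_def prod_power_delta)

lemma coeff2_eq: "coeff2 s lam j k m = moment_coeff s lam (delta2 j k) m"
proof -
  have "2 ^ 2 * pochhammer (real CARD('a) / 2 + real m) 2 =
      (real CARD('a) + 2 * real m + 2) * (real CARD('a) + 2 * real m)"
    by (simp add: numeral_2_eq_2 pochhammer_Suc algebra_simps)
  moreover have "(\<Prod>i\<in>UNIV. (s / lam$i) ^ delta2 j k i) = s / lam$j * (s / lam$k)"
    unfolding delta2_def by (rule prod_power_two_deltas)
  ultimately show ?thesis
    unfolding coeff2_def moment_coeff_def even_monomial_delta2 sum_delta2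
      by (simp only: mult.assoc)
qed

lemma alpha1_eq: "alpha1 \<rho> lam k = moment_alpha \<rho> lam (delta1 k)"
  unfolding alpha1_def moment_alpha_def delta1_def prod_power_delta ..

lemma alpha2_eq: "alpha2 \<rho> lam j k = moment_alpha \<rho> lam (delta2 j k)"
  unfolding alpha2_def moment_alpha_def delta2_def prod_power_two_deltas ..

lemma e1_eq: "e1 k i = 1 + 2 * real (delta1 k i)"
  by (simp add: e1_def delta1_def)

lemma e2_eq: "e2 j k i = 1 + 2 * real (delta2 j k i)"
  by (simp add: e2_def delta2_def)

lemma c0_delta1:
  fixes lam :: "real^'n"
  shows "(\<Prod>i\<in>UNIV. sqrt (s / lam$i) * (s / lam$i) ^ delta1 k i *
      (2 ^ delta1 k i * pochhammer (1 / 2) (delta1 k i))) =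
    s / lam$k * c0 s lam"
proof -
  have "2 ^ delta1 k i * pochhammer (1 / 2) (delta1 k i) = (1 :: real)" for i
    by (simp add: delta1_def)
  then show ?thesis
    by (simp add: prod.distrib c0_def) (simp add: delta1_def prod_power_delta)
qed

lemma c0_delta2:
  fixes lam :: "real^'n"
  shows "(\<Prod>i\<in>UNIV. sqrt (s / lam$i) * (s / lam$i) ^ delta2 j k i *
      (2 ^ delta2 j k i * pochhammer (1 / 2) (delta2 j k i))) =
    (1 + 2 * (if j = k then 1 else 0)) * (s / lam$j) * (s / lam$k) * c0 s lam"
proof -
  \<comment> \<open>This is (2p-1)!!, which is 1, 1, 3 for p = 0, 1, 2. The 3 occurs only for j = k
    at i = k and accounts for the factor 1 + 2 delta_jk.\<close>
  have 0: "2 ^ delta2 j k i * pochhammer (1 / 2) (delta2 j k i) =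
      (if i = k then (if j = k then 3 else 1) else 1 :: real)" for i
    by (auto simp: delta2_def numeral_2_eq_2 pochhammer_Suc)
  have 1: "(\<Prod>i\<in>UNIV. if i = k then (if j = k then 3 else 1) else 1) =
      (1 + 2 * (if j = k then 1 else 0) :: real)"
    by simp
  have 2: "(\<Prod>i\<in>UNIV. (s / lam$i) ^ delta2 j k i) = s / lam$j * (s / lam$k)"
    unfolding delta2_def by (rule prod_power_two_deltas)
  show ?thesis
    unfolding 0 by (simp only: prod.distrib 1 2 c0_def mult_ac)
qed

text \<open>Both arguments lie strictly between -pi/2 and pi/2, so their sum stays in the principal
  range and \<open>Ln\<close> is additive. It is needed because \<open>psi2\<close> for distinct
  indices raises a product of two factors to a single power.\<close>

lemma powr_mult_Re_pos:
  fixes a b w :: complex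
  assumes "Re a > 0" "Re b > 0"
  shows "(a * b) powr w = a powr w * b powr w"
proof -
  have nz: "a \<noteq> 0" "b \<noteq> 0" using assms by auto
  have "\<bar>Im (Ln a)\<bar> < pi / 2" "\<bar>Im (Ln b)\<bar> < pi / 2"
    using assms Re_Ln_pos_lt[OF nz(1)] Re_Ln_pos_lt[OF nz(2)] by blast+
  then have "Ln (a * b) = Ln a + Ln b"
    using nz by (intro Ln_times_simple) auto
  then show ?thesis using nz by (simp add: powr_def distrib_left exp_add)
qed


text \<open>The contribution of one coordinate whose exponent in the monomial weight is n. At n = 2
  the constant \<open>2 ^ n * pochhammer (1 / 2) n\<close> is the 3 in front of psi_kk.\<close>

definition psi_factor :: "real \<Rightarrow> complex \<Rightarrow> nat \<Rightarrow> complex" where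
  "psi_factor x w n =
     of_real (sqrt x * x ^ n * (2 ^ n * pochhammer (1 / 2) n)) * w powr
       (- of_real (1 / 2 + real n))"

lemma psi_factor_eqs:
  assumes "x > 0"
  shows "psi_factor x w 0 = of_real (x powr (1/2)) * w powr (-(1/2))"
    and "psi_factor x w 1 = of_real (x powr (3/2)) * w powr (-(3/2))"
    and "psi_factor x w 2 = 3 * of_real (x powr (5/2)) * w powr (-(5/2))"
proof -
  have 1: "x powr (3/2) = sqrt x * x"
    using assms powr_add[of x "1/2" 1] by (simp add: powr_half_sqrt)
  have 2: "x powr (5/2) = sqrt x * x\<^sup>2"
    using assms powr_add[of x "1/2" 2] by (simp add: powr_half_sqrt powr_numeral)
  show "psi_factor x w 0 = of_real (x powr (1/2)) * w powr (-(1/2))"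
    using assms by (simp add: psi_factor_def powr_half_sqrt)
  show "psi_factor x w 1 = of_real (x powr (3/2)) * w powr (-(3/2))"
    by (simp add: psi_factor_def 1)
  show "psi_factor x w 2 = 3 * of_real (x powr (5/2)) * w powr (-(5/2))"
    by (simp add: psi_factor_def 2 pochhammer_Suc numeral_2_eq_2)
qed

lemma half_factors_eq:
  assumes lam: "\<And>i. lam$i > 0" and s: "s > 0"
  shows "half_factors s lam S z = (\<Prod>i\<in>S. psi_factor (s / lam$i) (1 - of_real (1 - s / lam$i) * z)
      0)"
  unfolding half_factors_def using lam s by (simp only: psi_factor_eqs divide_pos_pos)

lemma psi1_eq:
  fixes lam :: "real^'n"
  assumes lam: "\<And>i. lam$i > 0" and s: "s > 0"
  shows "psi1 s lam k z = (\<Prod>i\<in>UNIV. psi_factor (s / lam$i) (1 - of_real (1 - s / lam$i) * z)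
      (delta1 k i))"
proof -
  have "(\<Prod>i\<in>UNIV. psi_factor (s / lam$i) (1 - of_real (1 - s / lam$i) * z) (delta1 k i)) =
      psi_factor (s / lam$k) (1 - of_real (1 - s / lam$k) * z) (delta1 k k) *
      (\<Prod>i\<in>UNIV - {k}. psi_factor (s / lam$i) (1 - of_real (1 - s / lam$i) * z) (delta1 k i))"
    by (rule prod.remove) auto
  also have "(\<Prod>i\<in>UNIV - {k}. psi_factor (s / lam$i) (1 - of_real (1 - s / lam$i) * z)
      (delta1 k i)) =
      half_factors s lam (UNIV - {k}) z"
    unfolding half_factors_eq[OF lam s] by (rule prod.cong) (auto simp: delta1_def)
  also have "delta1 k k = 1" by (simp add: delta1_def)
  finally show ?thesis
    unfolding psi1_def using lam s by (simp only: psi_factor_eqs divide_pos_pos)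
qed

lemma psi2_eq:
  fixes lam :: "real^'n"
  assumes lam: "\<And>i. lam$i > 0" and s: "s > 0" and z: "ereal (norm z) < gen_radius s lam"
  shows "psi2 s lam j k z = (\<Prod>i\<in>UNIV. psi_factor (s / lam$i) (1 - of_real (1 - s / lam$i) * z)
      (delta2 j k i))"
proof -
  let ?f = "\<lambda>i. psi_factor (s / lam$i) (1 - of_real (1 - s / lam$i) * z)"
  have pos: "s / lam$i > 0" for i using lam s by simp
  have k: "(\<Prod>i\<in>UNIV. ?f i (delta2 j k i)) =
      ?f k (delta2 j k k) * (\<Prod>i\<in>UNIV - {k}. ?f i (delta2 j k i))"
    by (rule prod.remove) auto
  show ?thesis
  proof (cases "j = k")
    case True
    have "(\<Prod>i\<in>UNIV - {k}. ?f i (delta2 j k i)) = half_factors s lam (UNIV - {k}) z"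
      unfolding half_factors_eq[OF lam s] by (rule prod.cong) (auto simp: delta2_def True)
    moreover have "delta2 j k k = 2" by (simp add: delta2_def True)
    ultimately show ?thesis
      unfolding psi2_def k using True by (simp only: psi_factor_eqs[OF pos] simp_thms if_True)
  next
    case False
    have j: "(\<Prod>i\<in>UNIV - {k}. ?f i (delta2 j k i)) =
        ?f j (delta2 j k j) * (\<Prod>i\<in>UNIV - {k} - {j}. ?f i (delta2 j k i))"
      using False by (intro prod.remove) auto
    have "UNIV - {k} - {j} = UNIV - {j, k}" by auto
    then have "(\<Prod>i\<in>UNIV - {k} - {j}. ?f i (delta2 j k i)) = half_factors s lam (UNIV - {j, k}) z"
      unfolding half_factors_eq[OF lam s] by (intro prod.cong) (auto simp: delta2_def)
    moreover have "delta2 j k j = 1" "delta2 j k k = 1" using False by (auto simp: delta2_def)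
    \<comment> \<open>Inside the radius the subtracted number has modulus below 1, so each factor
      lies in the right half-plane and the principal powers multiply.\<close>
    moreover have "Re (1 - of_real (1 - s / lam$i) * z) > 0" for i
      using norm_less_gen_radius[OF z, of i] complex_Re_le_cmod[of "of_real (1 - s / lam$i) * z"]
      by (simp only: minus_complex.simps one_complex.simps)
    then have "((1 - of_real (1 - s / lam$j) * z) * (1 - of_real (1 - s / lam$k) * z)) powr
        (-(3/2)) =
        (1 - of_real (1 - s / lam$j) * z) powr (-(3/2)) * (1 - of_real (1 - s / lam$k) * z) powr
          (-(3/2))"
      by (intro powr_mult_Re_pos)
    moreover have "(s / lam$j * (s / lam$k)) powr (3/2) =
        (s / lam$j) powr (3/2) * (s / lam$k) powr (3/2)"
      by (rule powr_mult)
    ultimately show ?thesis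
      unfolding psi2_def k j using False
        by (simp only: psi_factor_eqs[OF pos] if_False of_real_mult mult_ac)
  qed
qed

theorem theorem5p1:
  fixes \<rho> s :: real and lam :: "real^'n" and j k :: 'n
  assumes "\<rho> > 0" and "\<forall>i. lam$i > 0" and "s > 0"
  shows
    "(\<lambda>m. coeff1 s lam k m * chi_square_cdf (CARD('n) + 2 * (m + 1)) (\<rho> / s))
       sums alpha1 \<rho> lam k
     \<and> (\<lambda>m. coeff2 s lam j k m * chi_square_cdf (CARD('n) + 2 * (m + 2)) (\<rho> / s))
       sums alpha2 \<rho> lam j k
     \<and> (\<forall>I. is_interval I \<and> bounded I \<and> I \<subseteq> {0<..} \<longrightarrow>
          uniform_limit I
            (\<lambda>N r. \<Sum>m<N. coeff1 s lam k m * chi_square_cdf (CARD('n) + 2 * (m + 1)) (r / s))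
            (\<lambda>r. alpha1 r lam k) sequentially
          \<and> uniform_limit I
            (\<lambda>N r. \<Sum>m<N. coeff2 s lam j k m * chi_square_cdf (CARD('n) + 2 * (m + 2)) (r / s))
            (\<lambda>r. alpha2 r lam j k) sequentially)
     \<and> (\<forall>z::complex. ereal (norm z) < gen_radius s lam \<longrightarrow>
          (\<lambda>m. of_real (coeff1 s lam k m) * z ^ m) sums psi1 s lam k z
          \<and> (\<lambda>m. of_real (coeff2 s lam j k m) * z ^ m) sums psi2 s lam j k z)
     \<and> coeff1 s lam k 0 = s / lam$k * c0 s lam
     \<and> (\<forall>m\<ge>1. coeff1 s lam k m =
          1 / (2 * real m) * (\<Sum>r<m. g1 s lam k (m - r) * coeff1 s lam k r))
     \<and> coeff2 s lam j k 0 =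
          (1 + 2 * (if j = k then 1 else 0)) * (s / lam$j) * (s / lam$k) * c0 s lam
     \<and> (\<forall>m\<ge>1. coeff2 s lam j k m =
          1 / (2 * real m) * (\<Sum>r<m. g2 s lam j k (m - r) * coeff2 s lam j k r))"
proof (intro conjI allI impI)
  have lam: "\<And>i. lam$i > 0" and s: "s > 0" using assms by auto
  note eqs = coeff1_eq coeff2_eq alpha1_eq alpha2_eq
  note series1 = moment_series[OF lam s, where p = "delta1 k", unfolded sum_delta1]
  note series2 = moment_series[OF lam s, where p = "delta2 j k", unfolded sum_delta2]
  show "(\<lambda>m. coeff1 s lam k m * chi_square_cdf (CARD('n) + 2 * (m + 1)) (\<rho> / s)) sums alpha1 \<rho> lam k"
    unfolding eqs by (rule series1(1))
  show "(\<lambda>m. coeff2 s lam j k m * chi_square_cdf (CARD('n) + 2 * (m + 2)) (\<rho> / s)) sums alpha2 \<rho> lam j k"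
    unfolding eqs by (rule series2(1))
  show "uniform_limit I
      (\<lambda>N r. \<Sum>m<N. coeff1 s lam k m * chi_square_cdf (CARD('n) + 2 * (m + 1)) (r / s))
      (\<lambda>r. alpha1 r lam k) sequentially"
    and "uniform_limit I
      (\<lambda>N r. \<Sum>m<N. coeff2 s lam j k m * chi_square_cdf (CARD('n) + 2 * (m + 2)) (r / s))
      (\<lambda>r. alpha2 r lam j k) sequentially"
    if "is_interval I \<and> bounded I \<and> I \<subseteq> {0<..}" for I
  proof -
    from that obtain R where "\<forall>x\<in>I. norm x \<le> R" unfolding bounded_iff by blast
    then have I: "I \<subseteq> {..R}" by auto
    show "uniform_limit I
        (\<lambda>N r. \<Sum>m<N. coeff1 s lam k m * chi_square_cdf (CARD('n) + 2 * (m + 1)) (r / s))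
        (\<lambda>r. alpha1 r lam k) sequentially"
      unfolding eqs by (rule uniform_limit_on_subset[OF series1(2) I])
    show "uniform_limit I
        (\<lambda>N r. \<Sum>m<N. coeff2 s lam j k m * chi_square_cdf (CARD('n) + 2 * (m + 2)) (r / s))
        (\<lambda>r. alpha2 r lam j k) sequentially"
      unfolding eqs by (rule uniform_limit_on_subset[OF series2(2) I])
  qed
  show "(\<lambda>m. of_real (coeff1 s lam k m) * z ^ m) sums psi1 s lam k z"
    if "ereal (norm z) < gen_radius s lam" for z
    unfolding eqs psi1_eq[OF lam s] psi_factor_def by (rule moment_coeff_generating[OF lam s that])
  show "(\<lambda>m. of_real (coeff2 s lam j k m) * z ^ m) sums psi2 s lam j k z"
    if "ereal (norm z) < gen_radius s lam" for z
    unfolding eqs psi2_eq[OF lam s that] psi_factor_def by (rule moment_coeff_generating[OF lam s that])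
  show "coeff1 s lam k 0 = s / lam$k * c0 s lam"
    unfolding eqs moment_coeff_0[OF lam s] by (rule c0_delta1)
  show "coeff2 s lam j k 0 =
      (1 + 2 * (if j = k then 1 else 0)) * (s / lam$j) * (s / lam$k) * c0 s lam"
    unfolding eqs moment_coeff_0[OF lam s] by (rule c0_delta2)
  show "coeff1 s lam k m = 1 / (2 * real m) * (\<Sum>r<m. g1 s lam k (m - r) * coeff1 s lam k r)"
    if "1 \<le> m" for m
    unfolding eqs g1_def e1_eq by (rule moment_coeff_recursion[OF lam s that])
  show "coeff2 s lam j k m = 1 / (2 * real m) * (\<Sum>r<m. g2 s lam j k (m - r) * coeff2 s lam j k r)"
    if "1 \<le> m" for m
    unfolding eqs g2_def e2_eq by (rule moment_coeff_recursion[OF lam s that])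
qed

end
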